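(* There exist absolute constants $C,c_1,c_2,c_3,c_4>0$ such that for all $d\ge1$ and all $n\ge \max\{d,3\}$ the following hold for the multidimensional ERM estimator $\hat{\boldsymbol f}_{\mathsf{erm}}$: (1) if $\pi$ is supported on $[0,h]^d$, then $\mathsf{Regret}_\pi(\hat{\boldsymbol f}_{\mathsf{erm}})\le C\frac dn\max\{c_1,c_2h\}^{d+2}\big(\frac{\log n}{\log\log n}\big)^{d+1}$; (2) if every one-dimensional marginal of $\pi$ belongs to $\mathsf{SubE}(s)$ for some $s>0$, then $\mathsf{Regret}_\pi(\hat{\boldsymbol f}_{\mathsf{erm}})\le C\frac dn(\max\{c_3,c_4s\}\log n)^{d+2}$.
   Context: Multidimensional Poisson model. Let $\pi$ be a distribution on $\mathbb R_+^d$. Draw $\boldsymbol\theta\sim\pi$ and, given $\boldsymbol\theta$, let the coordinates $X_j\sim\mathrm{Poi}(\theta_j)$ be independent. The mixture pmf is $p_\pi(\boldsymbol x)=\int\prod_{j=1}^d e^{-\theta_j}\theta_j^{x_j}/x_j!\,d\pi(\boldsymbol\theta)$ for $\boldsymbol x\in\mathbb Z_+^d$. The Bayes estimator is $\boldsymbol f^*=(f^*_1,\dots,f^*_d)$ with $f^*_j(\boldsymbol x)=\mathbb E[\theta_j\mid\boldsymbol X=\boldsymbol x]=(x_j+1)p_\pi(\boldsymbol x+\boldsymbol e_j)/p_\pi(\boldsymbol x)$, where $\boldsymbol e_j$ is the $j$-th standard basis vector. The training sample $\boldsymbol X_1,\dots,\boldsymbol X_n$ is i.i.d. from $p_\pi$.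 Function class: $\boldsymbol{\mathcal F}=\{\boldsymbol f=(f_1,\dots,f_d):\mathbb Z_+^d\to\mathbb R_+^d:\ f_j(\boldsymbol x)\le f_j(\boldsymbol x+\boldsymbol e_j)\ \forall j,\forall\boldsymbol x\}$. The convention is $f_j(\boldsymbol x)=0$ whenever $x_j=-1$. ERM: $\hat{\boldsymbol f}_{\mathsf{erm}}$ minimizes $\frac1n\sum_{i=1}^n\big[\|\boldsymbol f(\boldsymbol X_i)\|^2-2\sum_{j=1}^dX_{ij}f_j(\boldsymbol X_i-\boldsymbol e_j)\big]$ over $\boldsymbol{\mathcal F}$. Its $j$-th coordinate is uniquely determined on $S_j=\{\boldsymbol X_i\}\cup\{\boldsymbol X_i-\boldsymbol e_j\}$. It is extended as follows: for $\boldsymbol x\notin S_j$, if some $y\ge0$ has $\boldsymbol x-y\boldsymbol e_j\in S_j$, set the value equal to that at $\boldsymbol x-y\boldsymbol e_j$ for the smallest such $y$; otherwise set it to $0$. Regret: $\mathsf{Regret}_\pi(\boldsymbol f)=\mathbb E\|\boldsymbol f(\boldsymbol X)-\boldsymbol\theta\|^2-\mathbb E\|\boldsymbol f^*(\boldsymbol X)-\boldsymbol\theta\|^2$, where $(\boldsymbol\theta,\boldsymbol X)$ is a fresh draw independent of the training sample, and the expectation is also over the training sample. $\mathsf{SubE}(s)=\{G \text{ distribution on }\mathbb R_+: G([t,\infty))\le 2e^{-t/s}\ \forall t>0\}$. *)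

theory Defs
  imports "HOL-Probability.Probability"
begin

(* Points of Z_+^d are functions nat => nat vanishing at coordinates >= d;
   parameters theta are functions nat => real (only coordinates < d matter). *)

definition Zd :: "nat \<Rightarrow> (nat \<Rightarrow> nat) set" where
  "Zd d = {x. \<forall>j. d \<le> j \<longrightarrow> x j = 0}"

definition poi :: "real \<Rightarrow> nat \<Rightarrow> real" where
  "poi t k = exp (- t) * t ^ k / fact k"

definition lik :: "nat \<Rightarrow> (nat \<Rightarrow> real) \<Rightarrow> (nat \<Rightarrow> nat) \<Rightarrow> real" where
  "lik d \<theta> x = (\<Prod>j<d. poi (\<theta> j) (x j))"

definition mixpmf :: "nat \<Rightarrow> (nat \<Rightarrow> real) measure \<Rightarrow> (nat \<Rightarrow> nat) \<Rightarrow> real" where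
  "mixpmf d \<pi> x = (\<integral>\<theta>. lik d \<theta> x \<partial>\<pi>)"

definition bayes :: "nat \<Rightarrow> (nat \<Rightarrow> real) measure \<Rightarrow> nat \<Rightarrow> (nat \<Rightarrow> nat) \<Rightarrow> real" where
  "bayes d \<pi> j x = real (x j + 1) * mixpmf d \<pi> (x(j := x j + 1)) / mixpmf d \<pi> x"

definition risk :: "nat \<Rightarrow> (nat \<Rightarrow> real) measure \<Rightarrow> (nat \<Rightarrow> (nat \<Rightarrow> nat) \<Rightarrow> real) \<Rightarrow> ennreal" where
  "risk d \<pi> f = (\<integral>\<^sup>+\<theta>. (\<integral>\<^sup>+x. ennreal (lik d \<theta> x * (\<Sum>j<d. (f j x - \<theta> j)\<^sup>2)) \<partial>count_space (Zd d)) \<partial>\<pi>)"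

definition monoF :: "nat \<Rightarrow> (nat \<Rightarrow> (nat \<Rightarrow> nat) \<Rightarrow> real) set" where
  "monoF d = {f. \<forall>j<d. \<forall>x\<in>Zd d. 0 \<le> f j x \<and> f j x \<le> f j (x(j := x j + 1))}"

definition emp_obj :: "nat \<Rightarrow> nat \<Rightarrow> (nat \<Rightarrow> nat \<Rightarrow> nat) \<Rightarrow> (nat \<Rightarrow> (nat \<Rightarrow> nat) \<Rightarrow> real) \<Rightarrow> real" where
  "emp_obj d n X f = (1 / real n) * (\<Sum>i<n. (\<Sum>j<d. (f j (X i))\<^sup>2 - 2 * real (X i j) * f j ((X i)(j := X i j - 1))))"

(* S_j: sample points and sample points minus e_j (those inside Z_+^d;
   points with coordinate -1 carry the convention value 0 and have weight 0) *)
definition Sj :: "nat \<Rightarrow> (nat \<Rightarrow> nat \<Rightarrow> nat) \<Rightarrow> nat \<Rightarrow> (nat \<Rightarrow> nat) set" where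
  "Sj n X j = X ` {..<n} \<union> {(X i)(j := X i j - 1) | i. i < n \<and> 1 \<le> X i j}"

definition erm_min :: "nat \<Rightarrow> nat \<Rightarrow> (nat \<Rightarrow> nat \<Rightarrow> nat) \<Rightarrow> (nat \<Rightarrow> (nat \<Rightarrow> nat) \<Rightarrow> real)" where
  "erm_min d n X = (SOME g. g \<in> monoF d \<and> (\<forall>f\<in>monoF d. emp_obj d n X g \<le> emp_obj d n X f))"

definition erm :: "nat \<Rightarrow> nat \<Rightarrow> (nat \<Rightarrow> nat \<Rightarrow> nat) \<Rightarrow> nat \<Rightarrow> (nat \<Rightarrow> nat) \<Rightarrow> real" where
  "erm d n X j x =
     (if x \<in> Sj n X j then erm_min d n X j x
      else if (\<exists>y. y \<le> x j \<and> x(j := x j - y) \<in> Sj n X j)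
      then erm_min d n X j (x(j := x j - (LEAST y. y \<le> x j \<and> x(j := x j - y) \<in> Sj n X j)))
      else 0)"

definition regret_erm :: "nat \<Rightarrow> nat \<Rightarrow> (nat \<Rightarrow> real) measure \<Rightarrow> ereal" where
  "regret_erm d n \<pi> =
     enn2ereal (\<integral>\<^sup>+X. (\<Prod>i<n. ennreal (mixpmf d \<pi> (X i))) * risk d \<pi> (erm d n X)
                   \<partial>count_space (PiE {..<n} (\<lambda>_. Zd d)))
     - enn2ereal (risk d \<pi> (bayes d \<pi>))"

end

theory Submission
  imports Defs
begin

text \<open>
  The regret is the expected squared \<open>L\<^sup>2(p)\<close> distance of the empirical minimizer from the Bayes estimator
  \<open>b\<close>, the conditional mean. Optimality of the minimizer in a convex class that contains \<open>b\<close> bounds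
  \<open>\<Sum>\<^sub>x N x * (g x)\<^sup>2\<close>, for \<open>g = erm - b\<close> and the cell counts \<open>N\<close>, by a sum of \<open>g x\<close> times a centred noise \<open>W x\<close>
  of variance \<open>n * p x * b x * (x j + 1 + b x)\<close>. Cell by cell, AM-GM turns this into a contribution
  \<open>b x * (x j + 1 + b x)\<close>, plus \<open>K\<^sup>2\<close> times \<open>n * p x\<close> on the event that \<open>N x\<close> falls below \<open>n * p x / 4\<close>,
  whose probability is at most \<open>exp (- n * p x / 4)\<close>. Summing over the cube \<open>{0..K}\<^sup>d\<close> that contains the whole sample
  with high probability gives the order \<open>K\<^sup>d\<^sup>+\<^sup>2\<close>, where \<open>K\<close> is of order \<open>s log n\<close> for subexponential
  priors. For priors on \<open>[0, h]\<^sup>d\<close>, \<open>K\<close> is of order \<open>h log n / log log n\<close>; there \<open>b \<le> h\<close> and \<open>p\<close> halves at each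
  step along a line beyond \<open>2 h\<close>, so one factor \<open>K\<close> improves to \<open>h\<close>.
\<close>


section \<open>Deterministic properties of the empirical minimizer\<close>

text \<open>The obstacle is that \<open>g\<close> depends on the whole sample, so centredness of
  \<open>W x\<close> says nothing about the mean of \<open>W x * g x\<close>. No uniform deviation
  bound over the monotone class is used: for each fixed sample the value \<open>g x\<close> is
  eliminated in each cell separately, and what remains involves only \<open>W x\<close> and
  \<open>N x\<close>, whose laws are explicit. This needs an a priori bound on \<open>g\<close> in
  cells that the sample hardly visits. It comes from two sides: every empirical minimizer stays
  below the largest observation, and cells where \<open>b\<close> exceeds a level \<open>L\<close>
  are set aside. Whatever is set aside is paid for with fourth moments and tail probabilities. Tails
  of order \<open>n^-7\<close> per coordinate leave \<open>n^-5\<close> after a union over at most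
  \<open>n^2\<close> events and \<open>n^-4\<close> after a union over the \<open>n\<close>
  observations; the last power still controls \<open>n\<close> times a sum of \<open>n\<close>
  squared observations on a bad sample.\<close>

lemma Zd_upd: "x \<in> Zd d \<Longrightarrow> j < d \<Longrightarrow> x(j := m) \<in> Zd d"
  by (auto simp: Zd_def)

lemma monoF_nonneg: "f \<in> monoF d \<Longrightarrow> j < d \<Longrightarrow> x \<in> Zd d \<Longrightarrow> 0 \<le> f j x"
  by (auto simp: monoF_def)

text \<open>At \<open>x j = 0\<close> truncated subtraction makes the predecessor \<open>x\<close>
  itself. This is harmless wherever it occurs, because the value at the predecessor is always
  weighted by \<open>x j\<close>.\<close>

lemma monoF_pred_le:
  assumes "f \<in> monoF d" "j < d" "x \<in> Zd d"
  shows "f j (x(j := x j - 1)) \<le> f j x"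
proof (cases "x j")
  case 0
  then have "x(j := x j - 1) = x" by (auto simp: fun_eq_iff)
  then show ?thesis by simp
next
  case (Suc m)
  define y where "y = x(j := x j - 1)"
  have "y \<in> Zd d" using Zd_upd[OF assms(3,2)] by (simp add: y_def)
  then have "f j y \<le> f j (y(j := y j + 1))" using assms by (auto simp: monoF_def)
  also have "y(j := y j + 1) = x" using Suc by (auto simp: y_def fun_eq_iff)
  finally show ?thesis unfolding y_def .
qed

text \<open>Here \<open>u\<close>, \<open>v\<close> are the values of an estimator at
  \<open>X i\<close> and at its predecessor, and \<open>b\<close> is \<open>X i j\<close>. If
  \<open>u > B\<close>, clipping saves \<open>u\<^sup>2 - B\<^sup>2\<close>, which is at least
  \<open>2 * B * (u - B)\<close>, and the linear term loses no more than that.\<close>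

lemma clipped_square_le:
  fixes u v b B :: real
  assumes "0 \<le> v" "v \<le> u" "0 \<le> b" "b \<le> B"
  shows "(min u B)\<^sup>2 - 2 * b * min v B \<le> u\<^sup>2 - 2 * b * v"
proof (cases "u \<le> B")
  case False
  have "b * (v - min v B) \<le> B * (u - B)"
    using assms False by (intro mult_mono) auto
  moreover have "0 \<le> (u - B)\<^sup>2" by simp
  ultimately show ?thesis
    using False by (simp add: algebra_simps power2_eq_square)
qed (use assms in auto)

lemma emp_obj_clip_le:
  assumes f: "f \<in> monoF d" and X: "\<And>i. i < n \<Longrightarrow> X i \<in> Zd d"
    and B: "\<And>i j. i < n \<Longrightarrow> j < d \<Longrightarrow> real (X i j) \<le> B"
  shows "emp_obj d n X (\<lambda>j x. min (f j x) B) \<le> emp_obj d n X f"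
  unfolding emp_obj_def
  using monoF_nonneg[OF f] monoF_pred_le[OF f] X B Zd_upd
  by (intro mult_left_mono sum_mono clipped_square_le) auto

lemma emp_obj_cong:
  assumes X: "\<And>i. i < n \<Longrightarrow> X i \<in> Zd d"
    and eq: "\<And>j x. j < d \<Longrightarrow> x \<in> Zd d \<Longrightarrow> f j x = g j x"
  shows "emp_obj d n X f = emp_obj d n X g"
  unfolding emp_obj_def using X Zd_upd eq by (intro arg_cong2[where f="(*)"] sum.cong) auto

text \<open>Justifies the \<open>SOME\<close> in \<open>erm_min\<close>. Clipping at a bound of the
  sample confines the search to a cube, compact by Tychonoff; monotonicity is a closed condition,
  and the objective is continuous since it reads finitely many values.\<close>

lemma erm_min_ex:
  assumes X: "\<And>i. i < n \<Longrightarrow> X i \<in> Zd d"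
  shows "\<exists>g \<in> monoF d. \<forall>f\<in>monoF d. emp_obj d n X g \<le> emp_obj d n X f"
proof -
  obtain B where B: "B \<ge> 0" "\<And>i j. i < n \<Longrightarrow> j < d \<Longrightarrow> real (X i j) \<le> B"
  proof
    show "(\<Sum>i<n. \<Sum>j<d. real (X i j)) \<ge> 0" by (simp add: sum_nonneg)
    fix i j assume "i < n" "j < d"
    then have "real (X i j) \<le> (\<Sum>j<d. real (X i j))" by (intro member_le_sum) auto
    also have "\<dots> \<le> (\<Sum>i<n. \<Sum>j<d. real (X i j))"
      using \<open>i < n\<close> by (intro member_le_sum[of i "{..<n}" "\<lambda>i. \<Sum>j<d. real (X i j)"]) (auto simp: sum_nonneg)
    finally show "real (X i j) \<le> (\<Sum>i<n. \<Sum>j<d. real (X i j))" .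
  qed
  define T :: "(nat \<times> (nat \<Rightarrow> nat) \<Rightarrow> real) set" where
    "T = PiE UNIV (\<lambda>_. {0..B}) \<inter> {F. curry F \<in> monoF d}"
  have "compactin (product_topology (\<lambda>_. euclidean) UNIV)
      (PiE (UNIV :: (nat \<times> (nat \<Rightarrow> nat)) set) (\<lambda>_. {0..B}))"
    by (simp add: compactin_PiE)
  then have 1: "compact (PiE (UNIV :: (nat \<times> (nat \<Rightarrow> nat)) set) (\<lambda>_. {0..B}))"
    by (simp add: euclidean_product_topology)
  have "{F. curry F \<in> monoF d} =
      (\<Inter>j\<in>{..<d}. \<Inter>x\<in>Zd d. {F. 0 \<le> F (j, x)} \<inter> {F. F (j, x) \<le> F (j, x(j := x j + 1))})"
    by (auto simp: monoF_def)
  also have "closed \<dots>"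
    by (intro closed_INT ballI closed_Int closed_Collect_le continuous_intros continuous_on_product_coordinates)
  finally have T: "compact T"
    unfolding T_def using 1 by (rule compact_Int_closed[rotated])
  have zero: "(\<lambda>_. 0) \<in> T"
    using B(1) by (auto simp: T_def monoF_def)
  have "continuous_on T (\<lambda>F. emp_obj d n X (curry F))"
    unfolding emp_obj_def curry_def
    by (intro continuous_intros continuous_on_subset[OF continuous_on_product_coordinates]) auto
  then obtain G where G: "G \<in> T" "\<And>F. F \<in> T \<Longrightarrow> emp_obj d n X (curry G) \<le> emp_obj d n X (curry F)"
    using continuous_attains_inf[OF T] zero by blast
  show ?thesis
  proof (intro bexI ballI)
    show "curry G \<in> monoF d" using G(1) by (auto simp: T_def)
    fix f assume f: "f \<in> monoF d"
    \<comment> \<open>Off \<open>d\<close> and \<open>Zd d\<close> the class leaves \<open>f\<close>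
      arbitrary, but membership in \<open>T\<close> requires values in \<open>[0, B]\<close>
      everywhere, hence the value 0 there.\<close>
    define F where "F = (\<lambda>(j, x). if j < d \<and> x \<in> Zd d then min (f j x) B else 0)"
    have "F \<in> T"
      using f B(1) Zd_upd unfolding T_def F_def monoF_def by (auto simp: min.coboundedI1)
    then have "emp_obj d n X (curry G) \<le> emp_obj d n X (curry F)" by (rule G)
    also have "\<dots> = emp_obj d n X (\<lambda>j x. min (f j x) B)"
      by (rule emp_obj_cong[OF X]) (auto simp: F_def)
    also have "\<dots> \<le> emp_obj d n X f"
      by (rule emp_obj_clip_le[OF f X B(2)])
    finally show "emp_obj d n X (curry G) \<le> emp_obj d n X f" .
  qed
qed

lemma erm_min:
  assumes X: "\<And>i. i < n \<Longrightarrow> X i \<in> Zd d"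
  shows "erm_min d n X \<in> monoF d"
    and "f \<in> monoF d \<Longrightarrow> emp_obj d n X (erm_min d n X) \<le> emp_obj d n X f"
  using someI_ex[OF erm_min_ex[OF X, unfolded Bex_def]] unfolding erm_min_def by auto

text \<open>First-order optimality condition, with the perturbation confined to coordinate \<open>j\<close>.\<close>

lemma erm_min_variational:
  assumes X: "\<And>i. i < n \<Longrightarrow> X i \<in> Zd d" and n: "n > 0" and j: "j < d"
    and v: "\<And>x. x \<in> Zd d \<Longrightarrow> 0 \<le> v x \<and> v x \<le> v (x(j := x j + 1))"
  shows "(\<Sum>i<n. real (X i j) * (v ((X i)(j := X i j - 1)) - erm_min d n X j ((X i)(j := X i j - 1))))
    \<le> (\<Sum>i<n. erm_min d n X j (X i) * (v (X i) - erm_min d n X j (X i)))"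
proof -
  define u where "u = erm_min d n X"
  define p where "p = (\<lambda>i. (X i)(j := X i j - 1))"
  define D where "D = (\<Sum>i<n. u j (X i) * (v (X i) - u j (X i)) - real (X i j) * (v (p i) - u j (p i)))"
  define Q where "Q = (\<Sum>i<n. (v (X i) - u j (X i))\<^sup>2)"
  have u: "u \<in> monoF d" unfolding u_def by (rule erm_min(1)[OF X])
  have pos: "0 \<le> 2 * D + t * Q" if t: "0 < t" "t \<le> 1" for t
  proof -
    define f where "f = u(j := \<lambda>x. (1 - t) * u j x + t * v x)"
    have "f \<in> monoF d"
      using u v t unfolding monoF_def f_def by (auto intro!: add_mono mult_left_mono add_nonneg_nonneg)
    then have "emp_obj d n X u \<le> emp_obj d n X f"
      unfolding u_def using erm_min(2)[of n X d f, OF X] by simp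
    then have "0 \<le> (\<Sum>i<n. \<Sum>k<d. (f k (X i))\<^sup>2 - 2 * real (X i k) * f k ((X i)(k := X i k - 1)))
       - (\<Sum>i<n. \<Sum>k<d. (u k (X i))\<^sup>2 - 2 * real (X i k) * u k ((X i)(k := X i k - 1)))"
      unfolding emp_obj_def using n by (simp add: divide_le_cancel)
    also have "\<dots> = (\<Sum>i<n. \<Sum>k<d. (f k (X i))\<^sup>2 - 2 * real (X i k) * f k ((X i)(k := X i k - 1))
       - ((u k (X i))\<^sup>2 - 2 * real (X i k) * u k ((X i)(k := X i k - 1))))"
      by (simp only: sum_subtractf)
    also have "\<dots> = (\<Sum>i<n. \<Sum>k<d. if k = j then 2 * t * (u j (X i) * (v (X i) - u j (X i))
       - real (X i j) * (v (p i) - u j (p i))) + t\<^sup>2 * (v (X i) - u j (X i))\<^sup>2 else 0)"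
      by (intro sum.cong refl) (auto simp: f_def p_def power2_eq_square algebra_simps)
    also have "\<dots> = 2 * t * D + t\<^sup>2 * Q"
      using j by (simp add: D_def Q_def sum.distrib sum_distrib_left)
    also have "\<dots> = t * (2 * D + t * Q)" by (simp add: power2_eq_square algebra_simps)
    finally show ?thesis using t by (simp add: zero_le_mult_iff)
  qed
  have "0 \<le> D"
  proof (rule ccontr)
    assume "\<not> 0 \<le> D"
    then have D: "D < 0" by simp
    have Q: "Q \<ge> 0" unfolding Q_def by (simp add: sum_nonneg)
    \<comment> \<open>If \<open>D < 0\<close>, this step makes \<open>t * Q \<le> - D\<close>, so
      \<open>2 * D + t * Q \<le> D < 0\<close>. The summand 1 guards against
      \<open>Q = 0\<close>.\<close>
    define t where "t = min 1 (- D / (Q + 1))"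
    have "0 < t" "t \<le> 1" using D Q by (auto simp: t_def divide_neg_pos)
    moreover have "t * Q \<le> - D"
    proof -
      have "t * Q \<le> (- D / (Q + 1)) * Q" using Q by (intro mult_right_mono) (auto simp: t_def)
      also have "\<dots> \<le> - D" using D Q by (simp add: field_simps)
      finally show ?thesis .
    qed
    ultimately show False using pos[of t] D by simp
  qed
  then show ?thesis unfolding D_def u_def p_def by (simp add: sum_subtractf)
qed

text \<open>Clipping only shows that some minimizer is bounded, whereas \<open>erm_min\<close> is an
  arbitrary one. Testing optimality against \<open>min u B\<close> bounds the sum of
  \<open>u * r\<close> at the sample by that of \<open>X i j * r\<close> at the predecessors, with
  excess \<open>r = u - min u B\<close>. Termwise the reverse holds, strictly wherever
  \<open>u > B\<close>.\<close>

lemma erm_min_le: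
  assumes X: "\<And>i. i < n \<Longrightarrow> X i \<in> Zd d" and n: "n > 0" and j: "j < d"
    and B: "B \<ge> 0" "\<And>i. i < n \<Longrightarrow> real (X i j) \<le> B" and i: "i < n"
  shows "erm_min d n X j (X i) \<le> B"
proof (rule ccontr)
  assume neg: "\<not> erm_min d n X j (X i) \<le> B"
  define u where "u = erm_min d n X j"
  define r where "r = (\<lambda>x. u x - min (u x) B)"
  define p where "p = (\<lambda>i. (X i)(j := X i j - 1))"
  have mono: "\<And>x. x \<in> Zd d \<Longrightarrow> 0 \<le> u x \<and> u x \<le> u (x(j := x j + 1))"
    using erm_min(1)[of n X d, OF X] j unfolding u_def monoF_def by simp
  have p: "u (p i) \<le> u (X i)" if "i < n" for i
    using monoF_pred_le[OF erm_min(1)[OF X] j X[OF that]] by (simp add: u_def p_def)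
  have "(\<Sum>i<n. real (X i j) * (min (u (p i)) B - u (p i))) \<le> (\<Sum>i<n. u (X i) * (min (u (X i)) B - u (X i)))"
    unfolding u_def p_def
  proof (rule erm_min_variational[OF X n j])
    fix x assume "x \<in> Zd d"
    then have "0 \<le> u x" "u x \<le> u (x(j := x j + 1))" using mono by auto
    then show "0 \<le> min (erm_min d n X j x) B \<and>
        min (erm_min d n X j x) B \<le> min (erm_min d n X j (x(j := x j + 1))) B"
      unfolding u_def using B(1) by auto
  qed
  then have *: "(\<Sum>i<n. u (X i) * r (X i)) \<le> (\<Sum>i<n. real (X i j) * r (p i))"
    by (simp add: r_def sum_subtractf right_diff_distrib)
  have le: "real (X k j) * r (p k) \<le> u (X k) * r (X k)" if "k < n" for k
  proof -
    have "r (p k) \<le> r (X k)" "0 \<le> r (p k)" using p[OF that] by (auto simp: r_def)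
    show ?thesis
    proof (cases "r (X k) = 0")
      case True with \<open>r (p k) \<le> r (X k)\<close> \<open>0 \<le> r (p k)\<close> show ?thesis by simp
    next
      case False
      then have "u (X k) > B" by (auto simp: r_def min_def split: if_splits)
      with B(2)[OF that] B(1) \<open>r (p k) \<le> r (X k)\<close> \<open>0 \<le> r (p k)\<close> show ?thesis
        by (intro mult_mono) auto
    qed
  qed
  have "real (X i j) * r (p i) < u (X i) * r (X i)"
  proof -
    have u: "u (X i) > B" "r (X i) > 0" using neg by (auto simp: u_def r_def)
    have "real (X i j) * r (p i) \<le> B * r (X i)"
      using p[OF i] B(1) B(2)[OF i] by (intro mult_mono) (auto simp: r_def)
    also have "\<dots> < u (X i) * r (X i)" using u by simp
    finally show ?thesis .
  qed
  then have "(\<Sum>i<n. real (X i j) * r (p i)) < (\<Sum>i<n. u (X i) * r (X i))"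
    using i le by (intro sum_strict_mono_ex1) auto
  with * show False by simp
qed

lemma Sj_subset_Zd:
  assumes "\<And>i. i < n \<Longrightarrow> X i \<in> Zd d" "j < d"
  shows "Sj n X j \<subseteq> Zd d"
  using assms Zd_upd by (auto simp: Sj_def)

text \<open>Values at predecessors lie below those at sample points by monotonicity, and the
  extension off \<open>Sj\<close> copies such a value or is 0. So the bound also covers cells that
  were never observed.\<close>

lemma erm_range:
  assumes X: "\<And>i. i < n \<Longrightarrow> X i \<in> Zd d" and n: "n > 0" and j: "j < d"
    and B: "B \<ge> 0" "\<And>i. i < n \<Longrightarrow> real (X i j) \<le> B"
  shows "0 \<le> erm d n X j x" "erm d n X j x \<le> B"
proof -
  have S: "0 \<le> erm_min d n X j y \<and> erm_min d n X j y \<le> B" if y: "y \<in> Sj n X j" for y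
  proof
    show "0 \<le> erm_min d n X j y"
      using monoF_nonneg[OF erm_min(1)[of n X d, OF X] j] Sj_subset_Zd[of n X d j, OF X j] y by blast
    show "erm_min d n X j y \<le> B"
      using y erm_min_le[OF X n j B] monoF_pred_le[OF erm_min(1)[of n X d, OF X] j X]
      by (force simp: Sj_def)
  qed
  have "\<exists>y. y \<le> x j \<and> x(j := x j - y) \<in> Sj n X j \<Longrightarrow>
    x(j := x j - (LEAST y. y \<le> x j \<and> x(j := x j - y) \<in> Sj n X j)) \<in> Sj n X j"
    by (drule LeastI_ex) auto
  then show "0 \<le> erm d n X j x" "erm d n X j x \<le> B"
    using S B(1) unfolding erm_def by auto
qed

text \<open>The optimality condition rewritten with \<open>erm = v + g\<close>. If \<open>v\<close>
  is the Bayes estimator and \<open>g\<close> is held fixed, the right-hand side has mean zero,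
  since \<open>X j * g\<close> at the predecessor of \<open>X\<close> and \<open>b j X * g X\<close>
  have the same mean.\<close>

lemma erm_basic_inequality:
  assumes X: "\<And>i. i < n \<Longrightarrow> X i \<in> Zd d" and n: "n > 0" and j: "j < d"
    and v: "\<And>x. x \<in> Zd d \<Longrightarrow> 0 \<le> v x \<and> v x \<le> v (x(j := x j + 1))"
  defines "g \<equiv> \<lambda>x. erm d n X j x - v x"
  shows "(\<Sum>i<n. (g (X i))\<^sup>2) \<le>
    (\<Sum>i<n. real (X i j) * g ((X i)(j := X i j - 1)) - v (X i) * g (X i))"
proof -
  \<comment> \<open>The extended estimator agrees with \<open>erm_min\<close> on \<open>Sj\<close>.
    A predecessor may fall outside \<open>Sj\<close> only for \<open>X i j = 0\<close>, where its
    weight vanishes.\<close>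
  have 1: "erm d n X j (X i) = erm_min d n X j (X i)" if "i < n" for i
    using that by (auto simp: erm_def Sj_def)
  have 2: "real (X i j) * erm d n X j ((X i)(j := X i j - 1)) =
      real (X i j) * erm_min d n X j ((X i)(j := X i j - 1))" if "i < n" for i
  proof (cases "X i j = 0")
    case False
    then have "(X i)(j := X i j - 1) \<in> Sj n X j" using that by (auto simp: Sj_def)
    then show ?thesis by (simp add: erm_def)
  qed simp
  let ?p = "\<lambda>i. (X i)(j := X i j - 1)"
  let ?u = "\<lambda>x. erm d n X j x"
  have "(\<Sum>i<n. real (X i j) * v (?p i) - real (X i j) * ?u (?p i))
      \<le> (\<Sum>i<n. ?u (X i) * (v (X i) - ?u (X i)))"
    using erm_min_variational[of n X d j v, OF X n j v] by (simp add: 1 2 right_diff_distrib del: One_nat_def)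
  then have "0 \<le> (\<Sum>i<n. ?u (X i) * (v (X i) - ?u (X i)) - (real (X i j) * v (?p i) - real (X i j) * ?u (?p i)))"
    by (simp add: sum_subtractf)
  also have "\<dots> = (\<Sum>i<n. real (X i j) * g (?p i) - v (X i) * g (X i)) - (\<Sum>i<n. (g (X i))\<^sup>2)"
    unfolding sum_subtractf[symmetric]
    by (intro sum.cong) (auto simp: g_def power2_eq_square algebra_simps)
  finally show ?thesis by simp
qed


section \<open>The Poisson mixture\<close>

lemma poi_nonneg: "0 \<le> t \<Longrightarrow> 0 \<le> poi t k"
  by (simp add: poi_def)

lemma poi_Suc: "real (Suc k) * poi t (Suc k) = t * poi t k"
  unfolding poi_def fact_Suc by (simp del: of_nat_Suc)

text \<open>The prior may charge rate 0, which corresponds to the point mass at 0;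
  \<open>poi\<close> agrees because \<open>0 ^ 0 = 1\<close>.\<close>

definition poi_pmf :: "real \<Rightarrow> nat pmf" where
  "poi_pmf t = (if t > 0 then poisson_pmf t else return_pmf 0)"

lemma pmf_poi_pmf: "0 \<le> t \<Longrightarrow> pmf (poi_pmf t) k = poi t k"
  by (cases "t = 0") (auto simp: poi_pmf_def poi_def indicator_def)

lemma nn_integral_power_poi_pmf:
  assumes "0 \<le> t" "0 \<le> z"
  shows "(\<integral>\<^sup>+k. ennreal (z ^ k) \<partial>poi_pmf t) = ennreal (exp (t * (z - 1)))"
proof -
  have "(\<integral>\<^sup>+k. ennreal (z ^ k) \<partial>poi_pmf t) = (\<integral>\<^sup>+k. ennreal (poi t k * z ^ k) \<partial>count_space UNIV)"
    using assms by (simp add: nn_integral_measure_pmf pmf_poi_pmf ennreal_mult poi_nonneg)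
  also have "\<dots> = (\<Sum>k. ennreal (exp (- t) * ((t * z) ^ k /\<^sub>R fact k)))"
    by (simp add: nn_integral_count_space_nat poi_def power_mult_distrib field_simps)
  also have "\<dots> = ennreal (exp (- t) * exp (t * z))"
    using assms sums_mult[OF exp_converges[of "t * z"], of "exp (- t)"]
    by (intro suminf_ennreal_eq) auto
  finally show ?thesis by (simp add: mult_exp_exp algebra_simps)
qed

lemma Zd_eq: "Zd d = PiE_dflt {..<d} 0 (\<lambda>_. UNIV)"
  by (auto simp: Zd_def PiE_dflt_def)

lemma countable_Zd: "countable (Zd d)"
  unfolding Zd_eq dflt_image_PiE[symmetric] by (intro countable_image countable_PiE) auto

lemma lik_nonneg: "(\<And>j. j < d \<Longrightarrow> 0 \<le> \<theta> j) \<Longrightarrow> 0 \<le> lik d \<theta> x"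
  unfolding lik_def by (intro prod_nonneg) (auto intro: poi_nonneg)

definition lik_pmf :: "nat \<Rightarrow> (nat \<Rightarrow> real) \<Rightarrow> (nat \<Rightarrow> nat) pmf" where
  "lik_pmf d \<theta> = Pi_pmf {..<d} 0 (\<lambda>j. poi_pmf (\<theta> j))"

lemma pmf_lik_pmf:
  assumes "\<And>j. j < d \<Longrightarrow> 0 \<le> \<theta> j"
  shows "pmf (lik_pmf d \<theta>) x = (if x \<in> Zd d then lik d \<theta> x else 0)"
  using assms by (auto simp: lik_pmf_def pmf_Pi Zd_def lik_def pmf_poi_pmf not_less intro!: prod.cong)

lemma nn_integral_lik:
  assumes "\<And>j. j < d \<Longrightarrow> 0 \<le> \<theta> j"
  shows "(\<integral>\<^sup>+x. ennreal (lik d \<theta> x) * \<phi> x \<partial>count_space (Zd d)) = (\<integral>\<^sup>+x. \<phi> x \<partial>lik_pmf d \<theta>)"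
  using assms
  by (auto simp: nn_integral_measure_pmf pmf_lik_pmf nn_integral_count_space_indicator
      intro!: nn_integral_cong)

lemma lik_le_1:
  assumes "\<And>j. j < d \<Longrightarrow> 0 \<le> \<theta> j"
  shows "lik d \<theta> x \<le> 1"
  unfolding lik_def
proof (intro prod_le_1 conjI)
  fix j assume "j \<in> {..<d}"
  then show "0 \<le> poi (\<theta> j) (x j)" "poi (\<theta> j) (x j) \<le> 1"
    using assms[of j] pmf_le_1[of "poi_pmf (\<theta> j)" "x j"] by (auto simp: poi_nonneg pmf_poi_pmf)
qed

text \<open>Source of all Bayes formulas below: multiplying the likelihood by
  \<open>\<theta> j\<close> amounts to shifting \<open>x j\<close> by one, so posterior moments of
  \<open>\<theta> j\<close> become values of \<open>mixpmf\<close> at shifted points.\<close>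

lemma lik_Suc:
  assumes "j < d"
  shows "real (x j + 1) * lik d \<theta> (x(j := x j + 1)) = \<theta> j * lik d \<theta> x"
proof -
  have "lik d \<theta> y = poi (\<theta> j) (y j) * (\<Prod>k\<in>{..<d} - {j}. poi (\<theta> k) (y k))" for y
    unfolding lik_def using assms by (subst prod.remove[of _ j]) auto
  moreover have "(\<Prod>k\<in>{..<d} - {j}. poi (\<theta> k) ((x(j := x j + 1)) k)) = (\<Prod>k\<in>{..<d} - {j}. poi (\<theta> k) (x k))"
    by (intro prod.cong) auto
  ultimately show ?thesis
    using poi_Suc[of "x j" "\<theta> j"] by simp
qed

section \<open>Mixing over the prior\<close>

locale poisson_mixture = prob_space \<pi> for \<pi> :: "(nat \<Rightarrow> real) measure" +
  fixes d :: nat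
  assumes sets_prior: "sets \<pi> = sets (PiM {..<d} (\<lambda>_. borel))"
    and AE_nonneg: "AE \<theta> in \<pi>. \<forall>j<d. 0 \<le> \<theta> j"
begin

lemma measurable_component [measurable]:
  assumes "j < d"
  shows "(\<lambda>\<theta>. \<theta> j) \<in> borel_measurable \<pi>"
proof -
  have "(\<lambda>\<theta>. \<theta> j) \<in> borel_measurable (PiM {..<d} (\<lambda>_. borel))"
    using assms by (intro measurable_component_singleton) auto
  then show ?thesis by (simp cong: measurable_cong_sets add: sets_prior)
qed

lemma measurable_lik [measurable]: "(\<lambda>\<theta>. lik d \<theta> x) \<in> borel_measurable \<pi>"
  unfolding lik_def poi_def by (intro borel_measurable_prod) auto

lemma AE_nonneg': "j < d \<Longrightarrow> AE \<theta> in \<pi>. 0 \<le> \<theta> j"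
  using AE_nonneg by eventually_elim auto

lemma AE_lik: "AE \<theta> in \<pi>. 0 \<le> lik d \<theta> x \<and> lik d \<theta> x \<le> 1"
  using AE_nonneg by eventually_elim (auto intro: lik_nonneg lik_le_1)

lemma integrable_lik: "integrable \<pi> (\<lambda>\<theta>. lik d \<theta> x)"
proof (rule integrable_const_bound[of _ 1])
  show "AE \<theta> in \<pi>. norm (lik d \<theta> x) \<le> 1" using AE_lik[of x] by eventually_elim auto
qed auto

abbreviation "p \<equiv> mixpmf d \<pi>"

lemma p_nonneg: "0 \<le> p x"
  unfolding mixpmf_def using AE_lik by (intro integral_nonneg_AE) auto

lemma nn_integral_lik_eq_p: "(\<integral>\<^sup>+\<theta>. ennreal (lik d \<theta> x) \<partial>\<pi>) = ennreal (p x)"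
  unfolding mixpmf_def using AE_lik by (intro nn_integral_eq_integral integrable_lik) auto

lemma nn_integral_mixture:
  "(\<integral>\<^sup>+x. ennreal (p x) * \<phi> x \<partial>count_space (Zd d)) = (\<integral>\<^sup>+\<theta>. (\<integral>\<^sup>+x. \<phi> x \<partial>lik_pmf d \<theta>) \<partial>\<pi>)"
proof -
  have "(\<integral>\<^sup>+x. ennreal (p x) * \<phi> x \<partial>count_space (Zd d)) =
      (\<integral>\<^sup>+x. (\<integral>\<^sup>+\<theta>. ennreal (lik d \<theta> x) * \<phi> x \<partial>\<pi>) \<partial>count_space (Zd d))"
    by (simp add: nn_integral_multc nn_integral_lik_eq_p)
  also have "\<dots> = (\<integral>\<^sup>+\<theta>. (\<integral>\<^sup>+x. ennreal (lik d \<theta> x) * \<phi> x \<partial>count_space (Zd d)) \<partial>\<pi>)"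
    by (rule nn_integral_count_space_nn_integral[symmetric]) (auto simp: countable_Zd)
  also have "\<dots> = (\<integral>\<^sup>+\<theta>. (\<integral>\<^sup>+x. \<phi> x \<partial>lik_pmf d \<theta>) \<partial>\<pi>)"
    by (rule nn_integral_cong_AE) (use AE_nonneg in eventually_elim, auto intro!: nn_integral_lik)
  finally show ?thesis .
qed

definition q :: "(nat \<Rightarrow> nat) pmf" where
  "q = embed_pmf (\<lambda>x. if x \<in> Zd d then p x else 0)"

lemma pmf_q: "pmf q x = (if x \<in> Zd d then p x else 0)"
  unfolding q_def
proof (rule pmf_embed_pmf)
  have "(\<integral>\<^sup>+x. ennreal (if x \<in> Zd d then p x else 0) \<partial>count_space UNIV) =
      (\<integral>\<^sup>+x. ennreal (p x) * 1 \<partial>count_space (Zd d))"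
    by (auto simp: nn_integral_count_space_indicator intro!: nn_integral_cong)
  also have "\<dots> = 1"
    unfolding nn_integral_mixture by (simp add: emeasure_space_1)
  finally show "(\<integral>\<^sup>+x. ennreal (if x \<in> Zd d then p x else 0) \<partial>count_space UNIV) = 1" .
qed (simp add: p_nonneg)

lemma nn_integral_q_eq:
  "(\<integral>\<^sup>+x. \<phi> x \<partial>q) = (\<integral>\<^sup>+x. ennreal (p x) * \<phi> x \<partial>count_space (Zd d))"
  by (auto simp: nn_integral_measure_pmf pmf_q nn_integral_count_space_indicator intro!: nn_integral_cong)

lemma nn_integral_q:
  "(\<integral>\<^sup>+x. \<phi> x \<partial>q) = (\<integral>\<^sup>+\<theta>. (\<integral>\<^sup>+x. \<phi> x \<partial>lik_pmf d \<theta>) \<partial>\<pi>)"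
  unfolding nn_integral_q_eq by (rule nn_integral_mixture)

lemma set_q: "x \<in> set_pmf q \<longleftrightarrow> x \<in> Zd d \<and> p x > 0"
  using p_nonneg[of x] by (auto simp: set_pmf_iff pmf_q)

text \<open>The probability generating function of a marginal. It turns exponential moments of the
  prior into tails of the observation; later \<open>z\<close> is \<open>ln n\<close> for bounded
  priors and \<open>1 + 1 / (2 * S)\<close> for subexponential ones.\<close>

lemma nn_integral_power_q:
  assumes "j < d" "0 \<le> z"
  shows "(\<integral>\<^sup>+x. ennreal (z ^ x j) \<partial>q) = (\<integral>\<^sup>+\<theta>. ennreal (exp (\<theta> j * (z - 1))) \<partial>\<pi>)"
  unfolding nn_integral_q
proof (rule nn_integral_cong_AE, use AE_nonneg in eventually_elim)
  fix \<theta> :: "nat \<Rightarrow> real" assume \<theta>: "\<forall>j<d. 0 \<le> \<theta> j"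
  have "(\<integral>\<^sup>+x. ennreal (z ^ x j) \<partial>lik_pmf d \<theta>) = (\<integral>\<^sup>+k. ennreal (z ^ k) \<partial>map_pmf (\<lambda>x. x j) (lik_pmf d \<theta>))"
    by simp
  also have "map_pmf (\<lambda>x. x j) (lik_pmf d \<theta>) = poi_pmf (\<theta> j)"
    using assms by (simp add: lik_pmf_def Pi_pmf_component)
  also have "(\<integral>\<^sup>+k. ennreal (z ^ k) \<partial>poi_pmf (\<theta> j)) = ennreal (exp (\<theta> j * (z - 1)))"
    using \<theta> assms by (intro nn_integral_power_poi_pmf) auto
  finally show "(\<integral>\<^sup>+x. ennreal (z ^ x j) \<partial>lik_pmf d \<theta>) = ennreal (exp (\<theta> j * (z - 1)))" .
qed

section \<open>The Bayes estimator: posterior moments, monotonicity, Jensen bound\<close>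

abbreviation "b \<equiv> bayes d \<pi>"

lemma moment1:
  assumes "j < d"
  shows "integrable \<pi> (\<lambda>\<theta>. \<theta> j * lik d \<theta> x)"
    and "(\<integral>\<theta>. \<theta> j * lik d \<theta> x \<partial>\<pi>) = real (x j + 1) * p (x(j := x j + 1))"
  unfolding lik_Suc[OF assms, symmetric] mixpmf_def using integrable_lik by auto

lemma moment2:
  assumes "j < d"
  shows "integrable \<pi> (\<lambda>\<theta>. (\<theta> j)\<^sup>2 * lik d \<theta> x)"
    and "(\<integral>\<theta>. (\<theta> j)\<^sup>2 * lik d \<theta> x \<partial>\<pi>) =
      real (x j + 1) * (real (x j + 2) * p (x(j := x j + 2)))"
proof -
  have "(\<theta> j)\<^sup>2 * lik d \<theta> x = real (x j + 1) * (real (x j + 2) * lik d \<theta> (x(j := x j + 2)))" for \<theta>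
  proof -
    have "(\<theta> j)\<^sup>2 * lik d \<theta> x = \<theta> j * (\<theta> j * lik d \<theta> x)" by (simp add: power2_eq_square)
    also have "\<dots> = real (x j + 1) * (\<theta> j * lik d \<theta> (x(j := x j + 1)))"
      using lik_Suc[OF assms, of x \<theta>] by (metis mult.left_commute)
    also have "\<theta> j * lik d \<theta> (x(j := x j + 1)) = real (x j + 2) * lik d \<theta> (x(j := x j + 2))"
      using lik_Suc[OF assms, of "x(j := x j + 1)" \<theta>] by (simp add: add.commute)
    finally show ?thesis .
  qed
  then show "integrable \<pi> (\<lambda>\<theta>. (\<theta> j)\<^sup>2 * lik d \<theta> x)"
    "(\<integral>\<theta>. (\<theta> j)\<^sup>2 * lik d \<theta> x \<partial>\<pi>) = real (x j + 1) * (real (x j + 2) * p (x(j := x j + 2)))"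
    using integrable_lik by (auto simp: mixpmf_def)
qed

lemma p_eq_0_AE: "p x = 0 \<Longrightarrow> AE \<theta> in \<pi>. lik d \<theta> x = 0"
  using integral_nonneg_eq_0_iff_AE[OF integrable_lik[of x]] AE_lik[of x] unfolding mixpmf_def by auto

lemma p_Suc_eq_0:
  assumes "j < d" "p x = 0"
  shows "p (x(j := x j + 1)) = 0"
proof -
  have "real (x j + 1) * p (x(j := x j + 1)) = (\<integral>\<theta>. \<theta> j * lik d \<theta> x \<partial>\<pi>)"
    by (rule moment1(2)[OF assms(1), symmetric])
  also have "\<dots> = (\<integral>\<theta>. 0 \<partial>\<pi>)"
    using p_eq_0_AE[OF assms(2)] by (intro integral_cong_AE) (use assms(1) in auto)
  finally show ?thesis by simp
qed

text \<open>True also in cells of mass zero: there \<open>bayes\<close> is 0 through division by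
  zero, and the shifted cell has mass zero by \<open>p_Suc_eq_0\<close>.\<close>

lemma p_b:
  assumes "j < d"
  shows "p x * b j x = real (x j + 1) * p (x(j := x j + 1))"
  using p_Suc_eq_0[OF assms, of x] by (auto simp: bayes_def)

lemma integral_b: "j < d \<Longrightarrow> (\<integral>\<theta>. \<theta> j * lik d \<theta> x \<partial>\<pi>) = p x * b j x"
  by (simp add: moment1 p_b del: of_nat_add)

lemma b_nonneg: "0 \<le> b j x"
  unfolding bayes_def using p_nonneg by (intro divide_nonneg_nonneg mult_nonneg_nonneg) auto

lemma integral_quadratic:
  assumes "j < d"
  shows "integrable \<pi> (\<lambda>\<theta>. lik d \<theta> x * (c - \<theta> j)\<^sup>2)"
    and "(\<integral>\<theta>. lik d \<theta> x * (c - \<theta> j)\<^sup>2 \<partial>\<pi>) =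
      (\<integral>\<theta>. lik d \<theta> x * (b j x - \<theta> j)\<^sup>2 \<partial>\<pi>) + p x * (c - b j x)\<^sup>2"
proof -
  have eq: "lik d \<theta> x * (c - \<theta> j)\<^sup>2 = c\<^sup>2 * lik d \<theta> x - 2 * c * (\<theta> j * lik d \<theta> x) + (\<theta> j)\<^sup>2 * lik d \<theta> x" for c \<theta>
    by (simp add: power2_eq_square algebra_simps)
  have int: "integrable \<pi> (\<lambda>\<theta>. lik d \<theta> x * (c - \<theta> j)\<^sup>2)" for c
    unfolding eq using integrable_lik moment1[OF assms] moment2[OF assms] by auto
  have val: "(\<integral>\<theta>. lik d \<theta> x * (c - \<theta> j)\<^sup>2 \<partial>\<pi>) =
     c\<^sup>2 * p x - 2 * c * (p x * b j x) + (\<integral>\<theta>. (\<theta> j)\<^sup>2 * lik d \<theta> x \<partial>\<pi>)" for c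
    unfolding eq using integrable_lik moment1(1)[OF assms] moment2(1)[OF assms]
    by (simp add: integral_b[OF assms] mixpmf_def)
  show "integrable \<pi> (\<lambda>\<theta>. lik d \<theta> x * (c - \<theta> j)\<^sup>2)" by (rule int)
  show "(\<integral>\<theta>. lik d \<theta> x * (c - \<theta> j)\<^sup>2 \<partial>\<pi>) =
      (\<integral>\<theta>. lik d \<theta> x * (b j x - \<theta> j)\<^sup>2 \<partial>\<pi>) + p x * (c - b j x)\<^sup>2"
    unfolding val by (simp add: power2_eq_square algebra_simps)
qed

text \<open>Nonnegative posterior variance: the second posterior moment of \<open>\<theta> j\<close>
  at \<open>x\<close> is \<open>b j x * b j (x(j := x j + 1))\<close> and dominates
  \<open>(b j x)\<^sup>2\<close>. This is what makes the Bayes estimator an admissible competitor in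
  the basic inequality.\<close>

lemma b_mono:
  assumes j: "j < d"
  shows "b j x \<le> b j (x(j := x j + 1))"
proof (cases "p (x(j := x j + 1)) = 0")
  case True
  then have "b j x = 0" by (simp add: bayes_def)
  then show ?thesis using b_nonneg by simp
next
  case False
  let ?y = "x(j := x j + 1)"
  have "p x \<noteq> 0" using False p_Suc_eq_0[OF j] by blast
  have "0 \<le> (\<integral>\<theta>. lik d \<theta> x * (b j x - \<theta> j)\<^sup>2 \<partial>\<pi>)"
    using AE_lik[of x] by (intro integral_nonneg_AE) auto
  then have "p x * b j x * b j x \<le> (\<integral>\<theta>. lik d \<theta> x * (0 - \<theta> j)\<^sup>2 \<partial>\<pi>)"
    unfolding integral_quadratic(2)[OF j, of _ 0] by (simp add: power2_eq_square)
  also have "(\<integral>\<theta>. lik d \<theta> x * (0 - \<theta> j)\<^sup>2 \<partial>\<pi>) = (\<integral>\<theta>. (\<theta> j)\<^sup>2 * lik d \<theta> x \<partial>\<pi>)"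
    by (simp add: mult.commute)
  also have "\<dots> = real (x j + 1) * (real (?y j + 1) * p (?y(j := ?y j + 1)))"
    by (simp add: moment2(2)[OF j])
  also have "\<dots> = real (x j + 1) * (p ?y * b j ?y)"
    using p_b[OF j, of ?y] by simp
  also have "\<dots> = p x * b j x * b j ?y"
    using p_b[OF j, of x] by simp
  finally have "p x * b j x * b j x \<le> p x * b j x * b j ?y" .
  moreover have "0 < p x * b j x"
    unfolding p_b[OF j] using False p_nonneg[of ?y] by (intro mult_pos_pos) auto
  ultimately show ?thesis by (simp only: mult_le_cancel_left_pos)
qed

text \<open>Conditional Jensen for the exponential, by its tangent line at \<open>b j x\<close>:
  integrated against the likelihood, the linear part drops out because \<open>b j x\<close> is the
  posterior mean.\<close>

lemma b_jensen:
  assumes j: "j < d"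
  shows "(\<integral>\<^sup>+x. ennreal (exp (a * b j x)) \<partial>q) \<le> (\<integral>\<^sup>+\<theta>. ennreal (exp (a * \<theta> j)) \<partial>\<pi>)"
proof -
  have "ennreal (p x) * ennreal (exp (a * b j x)) \<le> (\<integral>\<^sup>+\<theta>. ennreal (lik d \<theta> x) * ennreal (exp (a * \<theta> j)) \<partial>\<pi>)" for x
  proof -
    let ?E = "exp (a * b j x)"
    let ?h = "\<lambda>\<theta>. ?E * (lik d \<theta> x * (1 - a * b j x)) + ?E * a * (\<theta> j * lik d \<theta> x)"
    have int: "integrable \<pi> ?h" using integrable_lik moment1(1)[OF j] by auto
    have "(\<integral>\<theta>. ?h \<theta> \<partial>\<pi>) = ?E * (p x * (1 - a * b j x)) + ?E * a * (p x * b j x)"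
      using integrable_lik moment1(1)[OF j] by (simp add: integral_b[OF j] mixpmf_def)
    also have "\<dots> = p x * ?E" by (simp add: algebra_simps)
    finally have val: "(\<integral>\<theta>. ?h \<theta> \<partial>\<pi>) = p x * ?E" .
    \<comment> \<open>The tangent line \<open>?h\<close> may be negative, so its positive part is
      taken before passing to extended nonnegative integrals.\<close>
    have "(\<integral>\<theta>. ?h \<theta> \<partial>\<pi>) \<le> (\<integral>\<theta>. max 0 (?h \<theta>) \<partial>\<pi>)"
      by (intro integral_mono int integrable_max integrable_zero max.cobounded2)
    then have "ennreal (p x * ?E) \<le> ennreal (\<integral>\<theta>. max 0 (?h \<theta>) \<partial>\<pi>)"
      unfolding val by (rule ennreal_leI)
    also have "\<dots> = (\<integral>\<^sup>+\<theta>. ennreal (max 0 (?h \<theta>)) \<partial>\<pi>)"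
      using int by (intro nn_integral_eq_integral[symmetric]) auto
    also have "\<dots> \<le> (\<integral>\<^sup>+\<theta>. ennreal (lik d \<theta> x) * ennreal (exp (a * \<theta> j)) \<partial>\<pi>)"
    proof (rule nn_integral_mono_AE, use AE_lik[of x] in eventually_elim)
      fix \<theta> assume l: "0 \<le> lik d \<theta> x \<and> lik d \<theta> x \<le> 1"
      have "?h \<theta> = lik d \<theta> x * (?E * (1 + a * (\<theta> j - b j x)))" by (simp add: algebra_simps)
      also have "\<dots> \<le> lik d \<theta> x * (?E * exp (a * (\<theta> j - b j x)))"
        using l by (intro mult_left_mono exp_ge_add_one_self) auto
      also have "\<dots> = lik d \<theta> x * exp (a * \<theta> j)" by (simp add: mult_exp_exp algebra_simps)
      finally have "max 0 (?h \<theta>) \<le> lik d \<theta> x * exp (a * \<theta> j)" using l by simp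
      then show "ennreal (max 0 (?h \<theta>)) \<le> ennreal (lik d \<theta> x) * ennreal (exp (a * \<theta> j))"
        using l by (simp add: ennreal_mult[symmetric] del: max_less_iff_conj)
    qed
    finally show ?thesis by (simp add: ennreal_mult[symmetric] p_nonneg)
  qed
  then have "(\<integral>\<^sup>+x. ennreal (exp (a * b j x)) \<partial>q) \<le>
      (\<integral>\<^sup>+x. (\<integral>\<^sup>+\<theta>. ennreal (lik d \<theta> x) * ennreal (exp (a * \<theta> j)) \<partial>\<pi>) \<partial>count_space (Zd d))"
    unfolding nn_integral_q_eq by (intro nn_integral_mono) auto
  also have "\<dots> = (\<integral>\<^sup>+\<theta>. (\<integral>\<^sup>+x. ennreal (lik d \<theta> x) * ennreal (exp (a * \<theta> j)) \<partial>count_space (Zd d)) \<partial>\<pi>)"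
    using j by (intro nn_integral_count_space_nn_integral[symmetric]) (auto simp: countable_Zd)
  also have "\<dots> = (\<integral>\<^sup>+\<theta>. ennreal (exp (a * \<theta> j)) \<partial>\<pi>)"
    by (rule nn_integral_cong_AE) (use AE_nonneg in eventually_elim, auto simp: nn_integral_lik)
  finally show ?thesis .
qed

end


section \<open>Sums over an i.i.d. sample\<close>

lemma expectation_Pi_pmf_component:
  fixes u :: "'b \<Rightarrow> real"
  assumes "finite A" "i \<in> A"
  shows "measure_pmf.expectation (Pi_pmf A dflt (\<lambda>_. M)) (\<lambda>X. u (X i)) = measure_pmf.expectation M u"
proof -
  have "measure_pmf.expectation (Pi_pmf A dflt (\<lambda>_. M)) (\<lambda>X. u (X i)) =
      measure_pmf.expectation (map_pmf (\<lambda>X. X i) (Pi_pmf A dflt (\<lambda>_. M))) u"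
    by simp
  also have "map_pmf (\<lambda>X. X i) (Pi_pmf A dflt (\<lambda>_. M)) = M"
    using assms by (simp add: Pi_pmf_component)
  finally show ?thesis .
qed

lemma nn_integral_Pi_pmf_component:
  assumes "finite A" "i \<in> A"
  shows "(\<integral>\<^sup>+X. u (X i) \<partial>Pi_pmf A dflt (\<lambda>_. M)) = (\<integral>\<^sup>+x. u x \<partial>M)"
proof -
  have "(\<integral>\<^sup>+X. u (X i) \<partial>Pi_pmf A dflt (\<lambda>_. M)) = (\<integral>\<^sup>+x. u x \<partial>map_pmf (\<lambda>X. X i) (Pi_pmf A dflt (\<lambda>_. M)))"
    by simp
  also have "map_pmf (\<lambda>X. X i) (Pi_pmf A dflt (\<lambda>_. M)) = M"
    using assms by (simp add: Pi_pmf_component)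
  finally show ?thesis .
qed

lemma integrable_bounded_pmf:
  fixes f :: "'a \<Rightarrow> real"
  assumes "\<And>x. \<bar>f x\<bar> \<le> c"
  shows "integrable (measure_pmf M) f"
  by (rule measure_pmf.integrable_const_bound[of _ c]) (use assms in auto)

lemma expectation_Pi_pmf_mult:
  fixes u v :: "'b \<Rightarrow> real"
  assumes A: "finite A" "i \<in> A" "k \<in> A" "i \<noteq> k"
    and u: "\<And>x. \<bar>u x\<bar> \<le> c" and v: "\<And>x. \<bar>v x\<bar> \<le> c"
  shows "measure_pmf.expectation (Pi_pmf A dflt (\<lambda>_. M)) (\<lambda>X. u (X i) * v (X k)) =
    measure_pmf.expectation M u * measure_pmf.expectation M v"
proof -
  define P where "P = Pi_pmf A dflt (\<lambda>_. M)"
  define Y where "Y = (\<lambda>l X. (if l = i then u else v) (X l :: 'b))"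
  have ind: "prob_space.indep_vars (measure_pmf P) (\<lambda>_. count_space UNIV) (\<lambda>x f. f x) A"
    unfolding P_def using A(1) by (rule indep_vars_Pi_pmf)
  have ind2: "prob_space.indep_vars (measure_pmf P) (\<lambda>_. borel) Y {i, k}"
    unfolding Y_def
    by (rule prob_space.indep_vars_compose2[OF measure_pmf.prob_space_axioms
          prob_space.indep_vars_subset[OF measure_pmf.prob_space_axioms ind]]) (use A in auto)
  have int: "integrable (measure_pmf P) (Y l)" for l
    unfolding Y_def by (rule integrable_bounded_pmf[of _ c]) (use u v in auto)
  have "measure_pmf.expectation P (\<lambda>X. \<Prod>l\<in>{i, k}. Y l X) = (\<Prod>l\<in>{i, k}. measure_pmf.expectation P (Y l))"
    by (rule prob_space.indep_vars_lebesgue_integral[OF measure_pmf.prob_space_axioms _ ind2 int]) auto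
  then show ?thesis
    using A expectation_Pi_pmf_component[OF A(1,2), of dflt M u]
      expectation_Pi_pmf_component[OF A(1,3), of dflt M v]
    by (auto simp: Y_def P_def)
qed

lemma expectation_Pi_pmf_sum_sq:
  fixes w :: "'b \<Rightarrow> real"
  assumes A: "finite A" and w: "\<And>x. \<bar>w x\<bar> \<le> c" and zero: "measure_pmf.expectation M w = 0"
  shows "measure_pmf.expectation (Pi_pmf A dflt (\<lambda>_. M)) (\<lambda>X. (\<Sum>i\<in>A. w (X i))\<^sup>2) =
    real (card A) * measure_pmf.expectation M (\<lambda>x. (w x)\<^sup>2)"
proof -
  let ?E = "measure_pmf.expectation (Pi_pmf A dflt (\<lambda>_. M))"
  have b: "\<bar>w x * w y\<bar> \<le> c * c" for x y
    unfolding abs_mult using w[of x] w[of y] by (intro mult_mono) auto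
  have "?E (\<lambda>X. (\<Sum>i\<in>A. w (X i))\<^sup>2) = ?E (\<lambda>X. \<Sum>i\<in>A. \<Sum>k\<in>A. w (X i) * w (X k))"
    by (simp add: power2_eq_square sum_product)
  also have "\<dots> = (\<Sum>i\<in>A. \<Sum>k\<in>A. ?E (\<lambda>X. w (X i) * w (X k)))"
    by (simp add: integrable_bounded_pmf[OF b])
  also have "\<dots> = (\<Sum>i\<in>A. \<Sum>k\<in>A. if k = i then measure_pmf.expectation M (\<lambda>x. (w x)\<^sup>2) else 0)"
  proof (intro sum.cong refl)
    fix i k assume ik: "i \<in> A" "k \<in> A"
    show "?E (\<lambda>X. w (X i) * w (X k)) = (if k = i then measure_pmf.expectation M (\<lambda>x. (w x)\<^sup>2) else 0)"
    proof (cases "k = i")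
      case True
      then show ?thesis
        using expectation_Pi_pmf_component[OF A ik(1), of dflt M "\<lambda>x. (w x)\<^sup>2"] by (simp add: power2_eq_square)
    next
      case False
      then show ?thesis
        using expectation_Pi_pmf_mult[where u=w and v=w and dflt=dflt and M=M, OF A ik _ w w] zero by auto
    qed
  qed
  also have "\<dots> = real (card A) * measure_pmf.expectation M (\<lambda>x. (w x)\<^sup>2)"
    using A by simp
  finally show ?thesis .
qed

lemma expectation_indicator_pmf:
  "measure_pmf.expectation M (\<lambda>y. c * indicator {x} y) = c * pmf M x" for c :: real
  by (simp add: measure_pmf_single)

text \<open>Markov's inequality for \<open>2\<close> to the power minus the count. With
  \<open>a\<close> the expected count, this variable has mean at most \<open>exp (- a / 2)\<close>,
  and it is at least \<open>exp (- a / 4)\<close> once the count is below \<open>a / 4\<close>,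
  because \<open>ln 2 < 1\<close>.\<close>

lemma Chernoff_count_Pi_pmf:
  fixes M :: "'b pmf"
  assumes A: "finite A"
  shows "measure_pmf.prob (Pi_pmf A dflt (\<lambda>_. M))
      {X. (\<Sum>i\<in>A. indicator {x} (X i)) < real (card A) * pmf M x / 4}
    \<le> exp (- (real (card A) * pmf M x / 4))"
proof -
  define P where "P = Pi_pmf A dflt (\<lambda>_. M)"
  define a where "a = real (card A) * pmf M x"
  define N :: "('a \<Rightarrow> 'b) \<Rightarrow> real" where "N X = (\<Sum>i\<in>A. indicator {x} (X i))" for X
  define u :: "'b \<Rightarrow> real" where "u y = exp (- ln 2 * indicator {x} y)" for y
  have u: "u y = 1 - indicator {x} y / 2" for y
    unfolding u_def by (auto simp: indicator_def exp_minus)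
  have Eu: "measure_pmf.expectation M u = 1 - pmf M x / 2"
  proof -
    have "integrable M (\<lambda>y. indicator {x} y / 2 :: real)"
      by (rule integrable_bounded_pmf[of _ 1]) (auto simp: indicator_def)
    then show ?thesis unfolding u
      using expectation_indicator_pmf[of M "1/2" x] by simp
  qed
  have Nint: "integrable P (\<lambda>X. exp (a / 4) * exp (- ln 2 * N X))"
    by (rule integrable_bounded_pmf[of _ "exp (a / 4)"]) (auto simp: N_def sum_nonneg intro!: mult_left_le)
  have "measure_pmf.prob P {X. N X < a / 4} = measure_pmf.expectation P (indicator {X. N X < a / 4})"
    by simp
  also have "\<dots> \<le> measure_pmf.expectation P (\<lambda>X. exp (a / 4) * exp (- ln 2 * N X))"
  proof (rule integral_mono[OF _ Nint])
    show "integrable P (indicator {X. N X < a / 4} :: _ \<Rightarrow> real)"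
      by (rule integrable_bounded_pmf[of _ 1]) (auto simp: indicator_def)
    fix X
    have "1 \<le> exp (a / 4) * exp (- ln 2 * N X)" if "N X < a / 4"
    proof -
      have "0 \<le> N X" by (simp add: N_def sum_nonneg)
      then have "ln 2 * N X \<le> N X" using ln_2_less_1 by (intro mult_left_le_one_le) auto
      then have "0 \<le> a / 4 + (- ln 2 * N X)" using that by linarith
      then show ?thesis unfolding mult_exp_exp by (subst one_le_exp_iff)
    qed
    then show "indicator {X. N X < a / 4} X \<le> exp (a / 4) * exp (- ln 2 * N X)"
      by (auto simp: indicator_def)
  qed
  also have "\<dots> = exp (a / 4) * measure_pmf.expectation P (\<lambda>X. \<Prod>i\<in>A. u (X i))"
    unfolding N_def u_def exp_sum[OF A, symmetric] sum_distrib_left by simp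
  also have "measure_pmf.expectation P (\<lambda>X. \<Prod>i\<in>A. u (X i)) = (\<Prod>i\<in>A. measure_pmf.expectation M u)"
    unfolding P_def
  proof (rule expectation_prod_Pi_pmf[OF A])
    show "integrable (measure_pmf M) u"
      by (rule integrable_bounded_pmf[of _ 1]) (auto simp: u indicator_def)
  qed (auto simp: u_def)
  also have "\<dots> = (1 - pmf M x / 2) ^ card A" by (simp add: Eu)
  also have "\<dots> \<le> exp (- pmf M x / 2) ^ card A"
    using exp_ge_add_one_self[of "- pmf M x / 2"] pmf_le_1[of M x] by (intro power_mono) auto
  also have "\<dots> = exp (- a / 2)" by (simp add: a_def exp_of_nat_mult[symmetric])
  also have "exp (a / 4) * exp (- a / 2) = exp (- (a / 4))" by (simp add: mult_exp_exp)
  finally show ?thesis by (simp add: P_def N_def a_def)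
qed

section \<open>The i.i.d. sample and the regret\<close>

context poisson_mixture
begin

text \<open>The default \<open>undefined\<close> matches the extensional functions of the
  \<open>PiE\<close> over which \<open>regret_erm\<close> integrates.\<close>

definition sample :: "nat \<Rightarrow> (nat \<Rightarrow> nat \<Rightarrow> nat) pmf" where
  "sample n = Pi_pmf {..<n} undefined (\<lambda>_. q)"

lemma set_sample: "X \<in> set_pmf (sample n) \<Longrightarrow> i < n \<Longrightarrow> X i \<in> set_pmf q"
  by (auto simp: sample_def set_Pi_pmf PiE_dflt_def)

lemma nn_integral_sample:
  "(\<integral>\<^sup>+X. (\<Prod>i<n. ennreal (p (X i))) * \<Phi> X \<partial>count_space (PiE {..<n} (\<lambda>_. Zd d))) = (\<integral>\<^sup>+X. \<Phi> X \<partial>sample n)"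
proof -
  have "ennreal (pmf (sample n) X) * \<Phi> X =
     (\<Prod>i<n. ennreal (p (X i))) * \<Phi> X * indicator (PiE {..<n} (\<lambda>_. Zd d)) X" for X
  proof (cases "X \<in> PiE {..<n} (\<lambda>_. Zd d)")
    case True
    then have "pmf (sample n) X = (\<Prod>i<n. p (X i))"
      by (auto simp: sample_def pmf_Pi pmf_q PiE_def extensional_def intro!: prod.cong)
    then show ?thesis using True p_nonneg by (simp add: prod_ennreal)
  next
    case False
    then have "pmf (sample n) X = 0"
      by (auto simp: sample_def pmf_Pi pmf_q PiE_def extensional_def)
    then show ?thesis using False by simp
  qed
  then show ?thesis
    by (simp add: nn_integral_measure_pmf nn_integral_count_space_indicator)
qed

definition Q :: "nat \<Rightarrow> nat \<Rightarrow> (nat \<Rightarrow> nat \<Rightarrow> nat) \<Rightarrow> ennreal" where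
  "Q n j X = (\<integral>\<^sup>+x. ennreal ((erm d n X j x - b j x)\<^sup>2) \<partial>q)"

text \<open>The Bayes estimator is the conditional mean, so the cross term vanishes.\<close>

lemma risk_decompose:
  "risk d \<pi> f = risk d \<pi> b + (\<Sum>j<d. \<integral>\<^sup>+x. ennreal ((f j x - b j x)\<^sup>2) \<partial>q)"
proof -
  define R where "R f x = (\<integral>\<^sup>+\<theta>. ennreal (lik d \<theta> x * (\<Sum>j<d. (f j x - \<theta> j)\<^sup>2)) \<partial>\<pi>)"
    for f :: "nat \<Rightarrow> (nat \<Rightarrow> nat) \<Rightarrow> real" and x
  have risk: "risk d \<pi> f = (\<integral>\<^sup>+x. R f x \<partial>count_space (Zd d))" for f
    unfolding risk_def R_def
    by (rule nn_integral_count_space_nn_integral) (auto simp: countable_Zd)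
  have eq: "R f x = R b x + ennreal (p x) * (\<Sum>j<d. ennreal ((f j x - b j x)\<^sup>2))" for x
  proof -
    have R: "R f x = ennreal (\<Sum>j<d. \<integral>\<theta>. lik d \<theta> x * (f j x - \<theta> j)\<^sup>2 \<partial>\<pi>)" for f :: "nat \<Rightarrow> (nat \<Rightarrow> nat) \<Rightarrow> real"
    proof -
      have "R f x = ennreal (\<integral>\<theta>. (\<Sum>j<d. lik d \<theta> x * (f j x - \<theta> j)\<^sup>2) \<partial>\<pi>)"
        unfolding R_def sum_distrib_left
      proof (intro nn_integral_eq_integral)
        show "AE \<theta> in \<pi>. 0 \<le> (\<Sum>j<d. lik d \<theta> x * (f j x - \<theta> j)\<^sup>2)"
          using AE_lik[of x] by eventually_elim (auto intro!: sum_nonneg)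
      qed (auto intro!: integral_quadratic)
      also have "(\<integral>\<theta>. (\<Sum>j<d. lik d \<theta> x * (f j x - \<theta> j)\<^sup>2) \<partial>\<pi>) = (\<Sum>j<d. \<integral>\<theta>. lik d \<theta> x * (f j x - \<theta> j)\<^sup>2 \<partial>\<pi>)"
        by (rule Bochner_Integration.integral_sum) (auto intro!: integral_quadratic)
      finally show ?thesis .
    qed
    have nn: "0 \<le> (\<Sum>j<d. \<integral>\<theta>. lik d \<theta> x * (b j x - \<theta> j)\<^sup>2 \<partial>\<pi>)"
    proof (intro sum_nonneg integral_nonneg_AE)
      fix j show "AE \<theta> in \<pi>. 0 \<le> lik d \<theta> x * (b j x - \<theta> j)\<^sup>2"
        using AE_lik[of x] by eventually_elim auto
    qed
    have "(\<Sum>j<d. \<integral>\<theta>. lik d \<theta> x * (f j x - \<theta> j)\<^sup>2 \<partial>\<pi>) =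
        (\<Sum>j<d. \<integral>\<theta>. lik d \<theta> x * (b j x - \<theta> j)\<^sup>2 \<partial>\<pi>) + p x * (\<Sum>j<d. (f j x - b j x)\<^sup>2)"
      unfolding sum_distrib_left sum.distrib[symmetric]
      by (intro sum.cong refl integral_quadratic(2)) auto
    then have "R f x = ennreal (\<Sum>j<d. \<integral>\<theta>. lik d \<theta> x * (b j x - \<theta> j)\<^sup>2 \<partial>\<pi>) +
        ennreal (p x * (\<Sum>j<d. (f j x - b j x)\<^sup>2))"
      unfolding R[of f] using nn p_nonneg[of x]
      by (simp only: ennreal_plus[OF nn] mult_nonneg_nonneg sum_nonneg zero_le_power2)
    also have "ennreal (p x * (\<Sum>j<d. (f j x - b j x)\<^sup>2)) = ennreal (p x) * ennreal (\<Sum>j<d. (f j x - b j x)\<^sup>2)"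
      by (rule ennreal_mult) (auto simp: p_nonneg sum_nonneg)
    also have "ennreal (\<Sum>j<d. (f j x - b j x)\<^sup>2) = (\<Sum>j<d. ennreal ((f j x - b j x)\<^sup>2))"
      by (rule sum_ennreal[symmetric]) auto
    finally show ?thesis by (simp only: R[of b])
  qed
  have "risk d \<pi> f = (\<integral>\<^sup>+x. R b x + ennreal (p x) * (\<Sum>j<d. ennreal ((f j x - b j x)\<^sup>2)) \<partial>count_space (Zd d))"
    unfolding risk eq ..
  also have "\<dots> = risk d \<pi> b + (\<integral>\<^sup>+x. (\<Sum>j<d. ennreal ((f j x - b j x)\<^sup>2)) \<partial>q)"
    unfolding risk nn_integral_q_eq by (rule nn_integral_add) auto
  also have "(\<integral>\<^sup>+x. (\<Sum>j<d. ennreal ((f j x - b j x)\<^sup>2)) \<partial>q) = (\<Sum>j<d. \<integral>\<^sup>+x. ennreal ((f j x - b j x)\<^sup>2) \<partial>q)"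
    by (rule nn_integral_sum) auto
  finally show ?thesis .
qed

text \<open>The Bayes risk cancels only if it is finite. A second moment of the prior ensures this,
  by comparison with the zero estimator.\<close>

lemma regret_erm_eq:
  assumes fin: "\<And>j. j < d \<Longrightarrow> (\<integral>\<^sup>+\<theta>. ennreal ((\<theta> j)\<^sup>2) \<partial>\<pi>) < \<infinity>"
  shows "regret_erm d n \<pi> = enn2ereal (\<Sum>j<d. \<integral>\<^sup>+X. Q n j X \<partial>sample n)"
proof -
  have "risk d \<pi> b \<le> risk d \<pi> (\<lambda>_ _. 0)"
    unfolding risk_decompose[of "\<lambda>_ _. 0"] by simp
  also have "risk d \<pi> (\<lambda>_ _. 0) = (\<integral>\<^sup>+\<theta>. ennreal (\<Sum>j<d. (\<theta> j)\<^sup>2) \<partial>\<pi>)"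
    unfolding risk_def
  proof (rule nn_integral_cong_AE, use AE_nonneg in eventually_elim)
    fix \<theta> :: "nat \<Rightarrow> real" assume \<theta>: "\<forall>j<d. 0 \<le> \<theta> j"
    have "(\<integral>\<^sup>+x. ennreal (lik d \<theta> x * (\<Sum>j<d. (0 - \<theta> j)\<^sup>2)) \<partial>count_space (Zd d)) =
        (\<integral>\<^sup>+x. ennreal (lik d \<theta> x) * ennreal (\<Sum>j<d. (0 - \<theta> j)\<^sup>2) \<partial>count_space (Zd d))"
      using \<theta> by (intro nn_integral_cong ennreal_mult lik_nonneg sum_nonneg) auto
    also have "\<dots> = (\<integral>\<^sup>+x. ennreal (\<Sum>j<d. (0 - \<theta> j)\<^sup>2) \<partial>lik_pmf d \<theta>)"
      using \<theta> by (intro nn_integral_lik) auto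
    also have "\<dots> = ennreal (\<Sum>j<d. (\<theta> j)\<^sup>2)"
      by (simp add: measure_pmf.emeasure_space_1)
    finally show "(\<integral>\<^sup>+x. ennreal (lik d \<theta> x * (\<Sum>j<d. (0 - \<theta> j)\<^sup>2)) \<partial>count_space (Zd d)) = ennreal (\<Sum>j<d. (\<theta> j)\<^sup>2)" .
  qed
  also have "\<dots> = (\<integral>\<^sup>+\<theta>. (\<Sum>j<d. ennreal ((\<theta> j)\<^sup>2)) \<partial>\<pi>)"
    by (intro nn_integral_cong sum_ennreal[symmetric]) auto
  also have "\<dots> = (\<Sum>j<d. \<integral>\<^sup>+\<theta>. ennreal ((\<theta> j)\<^sup>2) \<partial>\<pi>)"
    by (rule nn_integral_sum) auto
  also have "\<dots> < \<infinity>" using fin by simp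
  finally have rb: "risk d \<pi> b < \<infinity>" .
  have "(\<integral>\<^sup>+X. (\<Prod>i<n. ennreal (p (X i))) * risk d \<pi> (erm d n X) \<partial>count_space (PiE {..<n} (\<lambda>_. Zd d))) =
      (\<integral>\<^sup>+X. risk d \<pi> b + (\<Sum>j<d. Q n j X) \<partial>sample n)"
    unfolding nn_integral_sample risk_decompose[of "erm d n _"] Q_def ..
  also have "\<dots> = risk d \<pi> b + (\<Sum>j<d. \<integral>\<^sup>+X. Q n j X \<partial>sample n)"
    by (simp add: nn_integral_add nn_integral_sum)
  finally have *: "(\<integral>\<^sup>+X. (\<Prod>i<n. ennreal (p (X i))) * risk d \<pi> (erm d n X) \<partial>count_space (PiE {..<n} (\<lambda>_. Zd d))) =
     risk d \<pi> b + (\<Sum>j<d. \<integral>\<^sup>+X. Q n j X \<partial>sample n)" .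
  have minus: "enn2ereal (u + v) - enn2ereal u = enn2ereal v" if u: "u < \<infinity>" for u v
  proof -
    obtain r where "r \<ge> 0" "u = ennreal r" using u by (cases u) auto
    then show ?thesis
      by (cases v) (auto simp: plus_ennreal.rep_eq)
  qed
  show ?thesis
    unfolding regret_erm_def * by (rule minus[OF rb])
qed

end


section \<open>Cellwise error of the empirical minimizer\<close>

text \<open>A Cauchy-Schwarz bound with a free parameter. In the applications with a small
  \<open>\<delta>\<close>, \<open>m\<close> is of order \<open>B ^ 4\<close> and
  \<open>\<epsilon>\<close> is \<open>1 / B\<^sup>2\<close> over a power of \<open>n\<close>, so
  that both summands become \<open>B\<^sup>2\<close> over the same power or smaller.\<close>

lemma sq_tail_bound:
  fixes y :: "'a \<Rightarrow> real"
  assumes m: "(\<integral>\<^sup>+x. ennreal ((y x)^4) \<partial>measure_pmf M) \<le> ennreal m" and "m \<ge> 0"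
    and A: "measure_pmf.prob M A \<le> \<delta>" and \<epsilon>: "\<epsilon> > 0"
  shows "(\<integral>\<^sup>+x. ennreal ((y x)\<^sup>2) * indicator A x \<partial>measure_pmf M) \<le> ennreal ((\<epsilon> * m + \<delta> / \<epsilon>) / 2)"
proof -
  have pt: "ennreal ((y x)\<^sup>2) * indicator A x \<le>
      ennreal (\<epsilon> / 2) * ennreal ((y x)^4) + ennreal (1 / (2 * \<epsilon>)) * indicator A x" for x
  proof (cases "x \<in> A")
    case True
    have "0 \<le> (\<epsilon> * (y x)\<^sup>2 - 1)\<^sup>2" by simp \<comment> \<open>AM-GM avoids any joint moment of \<open>y\<close> and \<open>A\<close>\<close>
    then have "2 * \<epsilon> * (y x)\<^sup>2 \<le> \<epsilon>\<^sup>2 * (y x)^4 + 1"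
      by (simp add: power2_eq_square power4_eq_xxxx algebra_simps)
    then have "(y x)\<^sup>2 \<le> \<epsilon> / 2 * (y x)^4 + 1 / (2 * \<epsilon>)"
      using \<epsilon> by (simp add: field_simps power2_eq_square)
    then have "ennreal ((y x)\<^sup>2) \<le> ennreal (\<epsilon> / 2 * (y x)^4 + 1 / (2 * \<epsilon>))" by (rule ennreal_leI)
    also have "\<dots> = ennreal (\<epsilon> / 2) * ennreal ((y x)^4) + ennreal (1 / (2 * \<epsilon>))"
      using \<epsilon> by (subst ennreal_plus) (auto simp: ennreal_mult[symmetric])
    finally show ?thesis using True by simp
  qed simp
  have "(\<integral>\<^sup>+x. ennreal ((y x)\<^sup>2) * indicator A x \<partial>M) \<le>
      (\<integral>\<^sup>+x. ennreal (\<epsilon> / 2) * ennreal ((y x)^4) + ennreal (1 / (2 * \<epsilon>)) * indicator A x \<partial>M)"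
    by (intro nn_integral_mono pt)
  also have "\<dots> = ennreal (\<epsilon> / 2) * (\<integral>\<^sup>+x. ennreal ((y x)^4) \<partial>M) + ennreal (1 / (2 * \<epsilon>)) * emeasure M A"
    by (simp add: nn_integral_add nn_integral_cmult)
  also have "\<dots> \<le> ennreal (\<epsilon> / 2) * ennreal m + ennreal (1 / (2 * \<epsilon>)) * ennreal \<delta>"
    using m A by (intro add_mono mult_left_mono) (auto simp: measure_pmf.emeasure_eq_measure intro: ennreal_leI)
  also have "\<dots> = ennreal (\<epsilon> / 2 * m + 1 / (2 * \<epsilon>) * \<delta>)"
  proof (subst ennreal_plus)
    show "0 \<le> \<epsilon> / 2 * m" "0 \<le> 1 / (2 * \<epsilon>) * \<delta>"
      using \<epsilon> \<open>m \<ge> 0\<close> order_trans[OF measure_nonneg A] by auto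
    have "ennreal (\<epsilon> / 2 * m) = ennreal (\<epsilon> / 2) * ennreal m"
      "ennreal (1 / (2 * \<epsilon>) * \<delta>) = ennreal (1 / (2 * \<epsilon>)) * ennreal \<delta>"
      using \<epsilon> \<open>m \<ge> 0\<close> order_trans[OF measure_nonneg A] by (auto simp: ennreal_mult[symmetric])
    then show "ennreal (\<epsilon> / 2) * ennreal m + ennreal (1 / (2 * \<epsilon>)) * ennreal \<delta> =
        ennreal (\<epsilon> / 2 * m) + ennreal (1 / (2 * \<epsilon>) * \<delta>)" by simp
  qed
  finally show ?thesis by (simp add: field_simps)
qed

context poisson_mixture
begin

text \<open>The level \<open>L\<close> is \<open>h\<close> for bounded priors and \<open>K\<close>
  for subexponential ones, where \<open>b\<close> is unbounded in general. Positive mass permits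
  division by \<open>n * p x\<close>.\<close>

definition good :: "nat \<Rightarrow> nat \<Rightarrow> real \<Rightarrow> (nat \<Rightarrow> nat) set" where
  "good j K L = {x \<in> Zd d. (\<forall>k<d. x k \<le> K) \<and> b j x \<le> L \<and> p x > 0}"

lemma box_eq: "{x \<in> Zd d. \<forall>k<d. x k \<le> K} = PiE_dflt {..<d} 0 (\<lambda>_. {..K})"
  unfolding Zd_def PiE_dflt_def by (rule set_eqI, simp only: mem_Collect_eq lessThan_iff atMost_iff) (meson not_less)

lemma finite_box: "finite {x \<in> Zd d. \<forall>k<d. x k \<le> K}"
  unfolding box_eq by (simp add: finite_PiE_dflt)

lemma finite_good: "finite (good j K L)"
  by (rule finite_subset[OF _ finite_box[of K]]) (auto simp: good_def)

text \<open>Going down in direction \<open>j\<close> keeps \<open>b j\<close> below \<open>L\<close>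
  by \<open>b_mono\<close> and keeps the mass positive by \<open>p_Suc_eq_0\<close>. Hence the
  predecessors in the basic inequality are good cells as well.\<close>

lemma good_pred:
  assumes j: "j < d" and x: "x \<in> good j K L" "x j \<ge> 1"
  shows "x(j := x j - 1) \<in> good j K L"
proof -
  define y where "y = x(j := x j - 1)"
  have x_eq: "y(j := y j + 1) = x" using x by (auto simp: y_def)
  have "y \<in> Zd d" using x j Zd_upd by (auto simp: good_def y_def)
  moreover have "\<forall>k<d. y k \<le> K" using x by (auto simp: good_def y_def intro: le_trans[OF diff_le_self])
  moreover have "b j y \<le> L" using b_mono[OF j, of y] x unfolding x_eq by (auto simp: good_def)
  moreover have "p y > 0"
    using p_Suc_eq_0[OF j, of y] p_nonneg[of y] x unfolding x_eq by (cases "p y = 0") (auto simp: good_def)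
  ultimately show ?thesis unfolding good_def y_def[symmetric] by simp
qed

text \<open>For \<open>g = erm - b\<close> the basic inequality reads \<open>\<Sum>\<^sub>x N x * (g x)\<^sup>2 \<le> \<Sum>\<^sub>x W x * g x\<close>, where every
  \<open>W x\<close> is a sum of i.i.d. centred variables \<open>w x (X i)\<close>.\<close>

definition N :: "nat \<Rightarrow> (nat \<Rightarrow> nat \<Rightarrow> nat) \<Rightarrow> (nat \<Rightarrow> nat) \<Rightarrow> real" where
  "N n X x = (\<Sum>i<n. indicator {x} (X i))"

text \<open>The coefficient of \<open>g x\<close> contributed by one observation \<open>y\<close> on
  the right of the basic inequality: a \<open>y\<close> one step above \<open>x\<close> has
  \<open>x\<close> as its predecessor and weight \<open>x j + 1\<close>.\<close>

definition w :: "nat \<Rightarrow> (nat \<Rightarrow> nat) \<Rightarrow> (nat \<Rightarrow> nat) \<Rightarrow> real" where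
  "w j x y = real (x j + 1) * indicator {x(j := x j + 1)} y - b j x * indicator {x} y"

definition W :: "nat \<Rightarrow> nat \<Rightarrow> (nat \<Rightarrow> nat \<Rightarrow> nat) \<Rightarrow> (nat \<Rightarrow> nat) \<Rightarrow> real" where
  "W n j X x = (\<Sum>i<n. w j x (X i))"

lemma N_nonneg: "0 \<le> N n X x"
  by (simp add: N_def sum_nonneg)

lemma sum_good_N:
  assumes X: "\<And>i. i < n \<Longrightarrow> X i \<in> good j K L"
  shows "(\<Sum>x\<in>good j K L. N n X x * G x) = (\<Sum>i<n. G (X i))"
proof -
  have "(\<Sum>x\<in>good j K L. N n X x * G x) = (\<Sum>x\<in>good j K L. \<Sum>i<n. indicator {x} (X i) * G x)"
    by (simp add: N_def sum_distrib_right)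
  also have "\<dots> = (\<Sum>i<n. \<Sum>x\<in>good j K L. indicator {x} (X i) * G x)"
    by (rule sum.swap)
  also have "\<dots> = (\<Sum>i<n. G (X i))"
  proof (rule sum.cong[OF refl])
    fix i assume "i \<in> {..<n}"
    then have "X i \<in> good j K L" using X by simp
    have "(\<Sum>x\<in>good j K L. indicator {x} (X i) * G x) = (\<Sum>x\<in>good j K L. if x = X i then G x else 0)"
      by (intro sum.cong) (auto simp: indicator_def)
    with \<open>X i \<in> good j K L\<close> show "(\<Sum>x\<in>good j K L. indicator {x} (X i) * G x) = G (X i)"
      by (simp add: finite_good)
  qed
  finally show ?thesis .
qed

lemma sum_good_W:
  assumes j: "j < d" and X: "\<And>i. i < n \<Longrightarrow> X i \<in> good j K L"
  shows "(\<Sum>x\<in>good j K L. W n j X x * G x) =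
    (\<Sum>i<n. real (X i j) * G ((X i)(j := X i j - 1)) - b j (X i) * G (X i))"
proof -
  have "(\<Sum>x\<in>good j K L. W n j X x * G x) = (\<Sum>i<n. \<Sum>x\<in>good j K L. w j x (X i) * G x)"
    unfolding W_def sum_distrib_right by (rule sum.swap)
  also have "\<dots> = (\<Sum>i<n. real (X i j) * G ((X i)(j := X i j - 1)) - b j (X i) * G (X i))"
  proof (rule sum.cong[OF refl])
    fix i assume "i \<in> {..<n}"
    then have Xi: "X i \<in> good j K L" using X by simp
    let ?y = "(X i)(j := X i j - 1)"
    \<comment> \<open>The guard is essential: for \<open>X i j = 0\<close> truncated subtraction
      returns \<open>X i\<close>, which is not one step below itself.\<close>
    have iff: "X i = x(j := x j + 1) \<longleftrightarrow> X i j \<ge> 1 \<and> x = ?y" for x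
      by (auto simp: fun_eq_iff split: if_splits)
    have 1: "(\<Sum>x\<in>good j K L. real (x j + 1) * indicator {x(j := x j + 1)} (X i) * G x) = real (X i j) * G ?y"
    proof (cases "X i j \<ge> 1")
      case True
      have "(\<Sum>x\<in>good j K L. real (x j + 1) * indicator {x(j := x j + 1)} (X i) * G x) =
          (\<Sum>x\<in>good j K L. if x = ?y then real (x j + 1) * G x else 0)"
        by (intro sum.cong refl) (simp only: indicator_def singleton_iff iff True, simp)
      also have "\<dots> = real (?y j + 1) * G ?y"
        using good_pred[OF j Xi True] by (simp only: sum.delta[OF finite_good] if_True)
      finally show ?thesis using True by simp
    next
      case False
      then have "X i \<noteq> x(j := x j + 1)" for x
        using iff[of x] by blast
      then have "indicator {x(j := x j + 1)} (X i) = (0 :: real)" for x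
        by (metis indicator_simps(2) singleton_iff)
      then have "(\<Sum>x\<in>good j K L. real (x j + 1) * indicator {x(j := x j + 1)} (X i) * G x) = (\<Sum>x\<in>good j K L. 0)"
        by (intro sum.cong refl) (simp only: mult_zero_left mult_zero_right)
      then show ?thesis using False by simp
    qed
    have "(\<Sum>x\<in>good j K L. b j x * indicator {x} (X i) * G x) = (\<Sum>x\<in>good j K L. if x = X i then b j x * G x else 0)"
      by (intro sum.cong) (auto simp: indicator_def)
    then have 2: "(\<Sum>x\<in>good j K L. b j x * indicator {x} (X i) * G x) = b j (X i) * G (X i)"
      using Xi by (simp add: finite_good)
    show "(\<Sum>x\<in>good j K L. w j x (X i) * G x) = real (X i j) * G ?y - b j (X i) * G (X i)"
      unfolding w_def left_diff_distrib sum_subtractf 1 2 ..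
  qed
  finally show ?thesis .
qed

text \<open>A bound for the cell's share of the error that no longer mentions the estimator: a noise
  term, and the crude \<open>(g x)\<^sup>2 \<le> B\<^sup>2\<close> in cells visited too
  rarely.\<close>

definition cell_error :: "nat \<Rightarrow> nat \<Rightarrow> real \<Rightarrow> (nat \<Rightarrow> nat \<Rightarrow> nat) \<Rightarrow> (nat \<Rightarrow> nat) \<Rightarrow> real" where
  "cell_error n j B X x = 16 * (W n j X x)\<^sup>2 / (real n * p x) +
     2 * (real n * p x) * B\<^sup>2 * indicator {X. N n X x < real n * p x / 4} X"

lemma cell_error_nonneg: "0 \<le> cell_error n j B X x"
  unfolding cell_error_def using p_nonneg by auto

text \<open>Eight times the nonnegative slack of the basic inequality is added. With
  \<open>a = n * p x\<close>, AM-GM bounds \<open>8 * W * g\<close> by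
  \<open>a * g\<^sup>2 + 16 * W\<^sup>2 / a\<close>, leaving
  \<open>(2 * a - 8 * N) * g\<^sup>2\<close>. The argument is pointwise in the sample, so the
  dependence of \<open>g\<close> on it does not matter.\<close>

lemma erm_error_good_sample:
  assumes j: "j < d" and n: "n > 0" and K: "real K \<le> B" and L: "L \<le> B"
    and X: "\<And>i. i < n \<Longrightarrow> X i \<in> good j K L"
  shows "real n * (\<Sum>x\<in>good j K L. p x * (erm d n X j x - b j x)\<^sup>2) \<le>
    (\<Sum>x\<in>good j K L. cell_error n j B X x)"
proof -
  let ?G = "good j K L"
  define g where "g x = erm d n X j x - b j x" for x
  have XZ: "\<And>i. i < n \<Longrightarrow> X i \<in> Zd d" using X by (auto simp: good_def)
  have XK: "\<And>i. i < n \<Longrightarrow> real (X i j) \<le> real K" using X j by (auto simp: good_def)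
  have r: "0 \<le> erm d n X j x" "erm d n X j x \<le> real K" for x
    using erm_range[where n=n and X=X and d=d, OF XZ n j _ XK] by auto
  have gB: "(g x)\<^sup>2 \<le> B\<^sup>2" if "x \<in> ?G" for x
  proof -
    have "b j x \<le> L" using that by (simp add: good_def)
    then have "\<bar>g x\<bar> \<le> B" unfolding g_def using r[of x] b_nonneg[of j x] K L by linarith
    then show ?thesis by (meson abs_le_square_iff abs_ge_self order_trans)
  qed
  have "(\<Sum>i<n. (g (X i))\<^sup>2) \<le> (\<Sum>i<n. real (X i j) * g ((X i)(j := X i j - 1)) - b j (X i) * g (X i))"
    unfolding g_def by (rule erm_basic_inequality[where v="b j", OF XZ n j]) (use b_nonneg b_mono[OF j] in blast)+
  then have basic: "(\<Sum>x\<in>?G. N n X x * (g x)\<^sup>2) \<le> (\<Sum>x\<in>?G. W n j X x * g x)"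
    by (simp only: sum_good_N[OF X] sum_good_W[OF j X])
  \<comment> \<open>The factor 8 makes \<open>2 * n * p x - 8 * N x\<close> nonpositive unless \<open>N x < n * p x / 4\<close>.\<close>
  have "real n * (\<Sum>x\<in>?G. p x * (g x)\<^sup>2) \<le> (\<Sum>x\<in>?G. real n * (p x * (g x)\<^sup>2)) +
      8 * ((\<Sum>x\<in>?G. W n j X x * g x) - (\<Sum>x\<in>?G. N n X x * (g x)\<^sup>2))"
    using basic by (simp add: sum_distrib_left[symmetric])
  also have "\<dots> = (\<Sum>x\<in>?G. real n * (p x * (g x)\<^sup>2) + 8 * (W n j X x * g x - N n X x * (g x)\<^sup>2))"
    by (simp add: sum.distrib sum_subtractf sum_distrib_left)
  also have "\<dots> \<le> (\<Sum>x\<in>?G. cell_error n j B X x)"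
  proof (rule sum_mono)
    fix x assume x: "x \<in> ?G"
    define a where "a = real n * p x"
    have a: "a > 0" using x n by (auto simp: a_def good_def)
    have "0 \<le> (a * g x - 4 * W n j X x)\<^sup>2 / a" using a by simp
    also have "\<dots> = a * (g x)\<^sup>2 - 8 * W n j X x * g x + 16 * (W n j X x)\<^sup>2 / a"
      using a by (simp add: power2_eq_square field_simps)
    finally have 1: "8 * W n j X x * g x \<le> a * (g x)\<^sup>2 + 16 * (W n j X x)\<^sup>2 / a" by simp
    have 2: "(2 * a - 8 * N n X x) * (g x)\<^sup>2 \<le> 2 * a * B\<^sup>2 * indicator {X. N n X x < a / 4} X"
    proof (cases "N n X x < a / 4")
      case True
      have "(2 * a - 8 * N n X x) * (g x)\<^sup>2 \<le> (2 * a) * B\<^sup>2"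
        using gB[OF x] N_nonneg[of n X x] a by (intro mult_mono) auto
      then show ?thesis using True by simp
    next
      case False
      then have "(2 * a - 8 * N n X x) * (g x)\<^sup>2 \<le> 0" by (intro mult_nonpos_nonneg) auto
      then show ?thesis using False by simp
    qed
    show "real n * (p x * (g x)\<^sup>2) + 8 * (W n j X x * g x - N n X x * (g x)\<^sup>2) \<le> cell_error n j B X x"
      unfolding cell_error_def a_def[symmetric] mult.assoc[of "real n" "p x", symmetric]
      using 1 2 by (simp add: algebra_simps)
  qed
  finally show ?thesis by (simp add: g_def)
qed

text \<open>Both claims rest on \<open>p_b\<close>. The two indicators have disjoint supports, so
  the square has no cross term.\<close>

lemma expectation_w:
  assumes j: "j < d" and x: "x \<in> Zd d"
  shows "measure_pmf.expectation q (w j x) = 0"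
    and "measure_pmf.expectation q (\<lambda>y. (w j x y)\<^sup>2) = p x * b j x * (real (x j + 1) + b j x)"
proof -
  let ?y = "x(j := x j + 1)"
  have ne: "?y \<noteq> x" by (metis fun_upd_same n_not_Suc_n Suc_eq_plus1)
  have int: "integrable q (\<lambda>z. c * indicator A z)" for c :: real and A
    by (rule integrable_bounded_pmf[of _ "\<bar>c\<bar>"]) (auto simp: indicator_def)
  have y: "?y \<in> Zd d" using Zd_upd[OF x j] .
  show "measure_pmf.expectation q (w j x) = 0"
    unfolding w_def using p_b[OF j, of x] x y
    by (subst Bochner_Integration.integral_diff[OF int int])
      (simp only: expectation_indicator_pmf pmf_q if_True, simp add: mult.commute)
  have eq: "(w j x z)\<^sup>2 = (real (x j + 1))\<^sup>2 * indicator {?y} z + (b j x)\<^sup>2 * indicator {x} z" for z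
    unfolding w_def using ne by (auto simp: indicator_def)
  have "measure_pmf.expectation q (\<lambda>y. (w j x y)\<^sup>2) = (real (x j + 1))\<^sup>2 * p ?y + (b j x)\<^sup>2 * p x"
    unfolding eq using x y
    by (subst Bochner_Integration.integral_add[OF int int]) (simp only: expectation_indicator_pmf pmf_q if_True)
  also have "(real (x j + 1))\<^sup>2 * p ?y = real (x j + 1) * (p x * b j x)"
    unfolding p_b[OF j, of x] by (simp add: power2_eq_square)
  finally show "measure_pmf.expectation q (\<lambda>y. (w j x y)\<^sup>2) = p x * b j x * (real (x j + 1) + b j x)"
    by (simp add: power2_eq_square algebra_simps)
qed

lemma w_bounded: "\<bar>w j x y\<bar> \<le> real (x j + 1) + b j x"
  unfolding w_def using b_nonneg[of j x] by (auto simp: indicator_def)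

lemma W_bounded: "(W n j X x)\<^sup>2 \<le> (real n * (real (x j + 1) + b j x))\<^sup>2"
proof -
  have "\<bar>W n j X x\<bar> \<le> (\<Sum>i<n. real (x j + 1) + b j x)"
    unfolding W_def by (rule order_trans[OF sum_abs sum_mono]) (rule w_bounded)
  then show ?thesis using b_nonneg[of j x] by (simp add: abs_le_square_iff[symmetric])
qed

text \<open>In the first summand \<open>p x\<close> has cancelled: the variance of
  \<open>W x\<close> is proportional to \<open>n * p x\<close>, so rare cells cost no more. The
  second is the Chernoff bound.\<close>

definition cell_bound :: "nat \<Rightarrow> nat \<Rightarrow> real \<Rightarrow> (nat \<Rightarrow> nat) \<Rightarrow> real" where
  "cell_bound n j B x = 16 * b j x * (real (x j + 1) + b j x) +
     2 * B\<^sup>2 * (real n * p x * exp (- (real n * p x / 4)))"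

lemma cell_bound_nonneg: "0 \<le> cell_bound n j B x"
  unfolding cell_bound_def using b_nonneg p_nonneg by auto

lemma nn_integral_cell_error:
  assumes j: "j < d" and n: "n > 0" and x: "x \<in> good j K L"
  shows "(\<integral>\<^sup>+X. ennreal (cell_error n j B X x) \<partial>sample n) \<le> ennreal (cell_bound n j B x)"
proof -
  define a where "a = real n * p x"
  have a: "a > 0" and xZ: "x \<in> Zd d" using x n by (auto simp: a_def good_def)
  let ?A = "{X. N n X x < a / 4}"
  have int1: "integrable (sample n) (\<lambda>X. 16 / a * (W n j X x)\<^sup>2)"
    by (rule integrable_mult_right, rule integrable_bounded_pmf[of _ "(real n * (real (x j + 1) + b j x))\<^sup>2"])
      (use W_bounded[of n j _ x] in auto)
  have int2: "integrable (sample n) (\<lambda>X. 2 * a * B\<^sup>2 * indicator ?A X)"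
    by (rule integrable_bounded_pmf[of _ "2 * a * B\<^sup>2"]) (use a in \<open>auto simp: indicator_def\<close>)
  have ce: "cell_error n j B X x = 16 / a * (W n j X x)\<^sup>2 + 2 * a * B\<^sup>2 * indicator ?A X" for X
    unfolding cell_error_def a_def by simp
  have "(\<integral>\<^sup>+X. ennreal (cell_error n j B X x) \<partial>sample n) = ennreal (measure_pmf.expectation (sample n) (\<lambda>X. cell_error n j B X x))"
  proof (rule nn_integral_eq_integral)
    show "integrable (sample n) (\<lambda>X. cell_error n j B X x)"
      unfolding ce by (rule Bochner_Integration.integrable_add[OF int1 int2])
  qed (simp add: cell_error_nonneg)
  also have "measure_pmf.expectation (sample n) (\<lambda>X. cell_error n j B X x) =
      16 / a * measure_pmf.expectation (sample n) (\<lambda>X. (W n j X x)\<^sup>2) + 2 * a * B\<^sup>2 * measure_pmf.prob (sample n) ?A"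
    unfolding ce by (subst Bochner_Integration.integral_add[OF int1 int2]) simp
  also have "measure_pmf.expectation (sample n) (\<lambda>X. (W n j X x)\<^sup>2) = real n * (p x * b j x * (real (x j + 1) + b j x))"
    unfolding W_def sample_def
    by (subst expectation_Pi_pmf_sum_sq[OF _ w_bounded expectation_w(1)[OF j xZ]]) (auto simp: expectation_w(2)[OF j xZ])
  also have "16 / a * (real n * (p x * b j x * (real (x j + 1) + b j x))) = 16 * b j x * (real (x j + 1) + b j x)"
    using n x by (simp add: a_def good_def divide_simps)
  also have "ennreal (16 * b j x * (real (x j + 1) + b j x) + 2 * a * B\<^sup>2 * measure_pmf.prob (sample n) ?A)
      \<le> ennreal (cell_bound n j B x)"
  proof (rule ennreal_leI)
    have "measure_pmf.prob (sample n) ?A \<le> exp (- (a / 4))"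
      using Chernoff_count_Pi_pmf[of "{..<n}" undefined q x] xZ by (simp add: sample_def N_def a_def pmf_q)
    then have "2 * a * B\<^sup>2 * measure_pmf.prob (sample n) ?A \<le> 2 * a * B\<^sup>2 * exp (- (a / 4))"
      using a by (intro mult_left_mono) auto
    then show "16 * b j x * (real (x j + 1) + b j x) + 2 * a * B\<^sup>2 * measure_pmf.prob (sample n) ?A
        \<le> cell_bound n j B x"
      unfolding cell_bound_def a_def[symmetric] by (simp add: mult_ac)
  qed
  finally show ?thesis .
qed

end


section \<open>Good and bad samples: expected loss in one coordinate\<close>

context poisson_mixture
begin

lemma nn_integral_indicator_good:
  assumes f: "\<And>x. 0 \<le> f x"
  shows "(\<integral>\<^sup>+x. ennreal (f x) * indicator (good j K L) x \<partial>q) = ennreal (\<Sum>x\<in>good j K L. p x * f x)"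
proof -
  have "(\<integral>\<^sup>+x. ennreal (f x) * indicator (good j K L) x \<partial>q) =
      (\<integral>\<^sup>+x. ennreal (p x * f x) * indicator (good j K L) x \<partial>count_space UNIV)"
    unfolding nn_integral_measure_pmf
    by (intro nn_integral_cong) (auto simp: pmf_q good_def ennreal_mult f p_nonneg indicator_def)
  also have "\<dots> = (\<Sum>x\<in>good j K L. ennreal (p x * f x))"
    by (simp add: nn_integral_count_space_indicator[symmetric] nn_integral_count_space_finite finite_good)
  also have "\<dots> = ennreal (\<Sum>x\<in>good j K L. p x * f x)"
    using f p_nonneg by (intro sum_ennreal) auto
  finally show ?thesis .
qed

text \<open>Off the good cells both estimators are nonnegative, so the squared difference is at most
  the sum of squares, with \<open>erm\<close> still below \<open>K\<close> because the sample lies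
  in the box.\<close>

lemma Q_good_sample:
  assumes j: "j < d" and n: "n > 0" and K: "real K \<le> B" and L: "L \<le> B"
    and X: "\<And>i. i < n \<Longrightarrow> X i \<in> good j K L"
  shows "ennreal (real n) * Q n j X \<le> (\<Sum>x\<in>good j K L. ennreal (cell_error n j B X x)) +
     ennreal (real n) * (\<integral>\<^sup>+x. ennreal ((real K)\<^sup>2 + (b j x)\<^sup>2) * indicator (- good j K L) x \<partial>q)"
proof -
  let ?G = "good j K L"
  let ?g = "\<lambda>x. (erm d n X j x - b j x)\<^sup>2"
  have XZ: "\<And>i. i < n \<Longrightarrow> X i \<in> Zd d" using X by (auto simp: good_def)
  have XK: "\<And>i. i < n \<Longrightarrow> real (X i j) \<le> real K" using X j by (auto simp: good_def)
  have g: "?g x \<le> (real K)\<^sup>2 + (b j x)\<^sup>2" for x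
  proof -
    have r: "0 \<le> erm d n X j x" "erm d n X j x \<le> real K"
      using erm_range[where n=n and X=X and d=d, OF XZ n j _ XK] by auto
    then have "(erm d n X j x)\<^sup>2 \<le> (real K)\<^sup>2" by (intro power_mono) auto
    moreover have "0 \<le> erm d n X j x * b j x" using r b_nonneg by simp
    ultimately show ?thesis by (simp add: power2_diff)
  qed
  have "Q n j X = (\<integral>\<^sup>+x. ennreal (?g x) * indicator ?G x + ennreal (?g x) * indicator (- ?G) x \<partial>q)"
    unfolding Q_def by (intro nn_integral_cong) (auto simp: indicator_def)
  also have "\<dots> = ennreal (\<Sum>x\<in>?G. p x * ?g x) + (\<integral>\<^sup>+x. ennreal (?g x) * indicator (- ?G) x \<partial>q)"
    by (subst nn_integral_add) (auto simp: nn_integral_indicator_good)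
  finally have "ennreal (real n) * Q n j X = ennreal (real n * (\<Sum>x\<in>?G. p x * ?g x)) +
      ennreal (real n) * (\<integral>\<^sup>+x. ennreal (?g x) * indicator (- ?G) x \<partial>q)"
    using p_nonneg by (simp add: distrib_left ennreal_mult sum_nonneg)
  also have "\<dots> \<le> (\<Sum>x\<in>?G. ennreal (cell_error n j B X x)) +
     ennreal (real n) * (\<integral>\<^sup>+x. ennreal ((real K)\<^sup>2 + (b j x)\<^sup>2) * indicator (- ?G) x \<partial>q)"
  proof (intro add_mono mult_left_mono)
    have "ennreal (real n * (\<Sum>x\<in>?G. p x * ?g x)) \<le> ennreal (\<Sum>x\<in>?G. cell_error n j B X x)"
      by (intro ennreal_leI erm_error_good_sample[OF j n K L X])
    also have "\<dots> = (\<Sum>x\<in>?G. ennreal (cell_error n j B X x))"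
      by (intro sum_ennreal[symmetric] cell_error_nonneg)
    finally show "ennreal (real n * (\<Sum>x\<in>?G. p x * ?g x)) \<le> (\<Sum>x\<in>?G. ennreal (cell_error n j B X x))" .
    show "(\<integral>\<^sup>+x. ennreal (?g x) * indicator (- ?G) x \<partial>q) \<le>
        (\<integral>\<^sup>+x. ennreal ((real K)\<^sup>2 + (b j x)\<^sup>2) * indicator (- ?G) x \<partial>q)"
      by (intro nn_integral_mono mult_right_mono ennreal_leI g) auto
  qed auto
  finally show ?thesis .
qed

lemma Q_any_sample:
  assumes j: "j < d" and n: "n > 0" and X: "\<And>i. i < n \<Longrightarrow> X i \<in> Zd d"
  shows "Q n j X \<le> (\<Sum>i<n. ennreal ((real (X i j))\<^sup>2)) + (\<integral>\<^sup>+x. ennreal ((b j x)\<^sup>2) \<partial>q)"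
proof -
  \<comment> \<open>The Euclidean norm replaces the maximum of the sample so that the bound splits
    into a sum over observations.\<close>
  define B where "B = sqrt (\<Sum>i<n. (real (X i j))\<^sup>2)"
  have S: "0 \<le> (\<Sum>i<n. (real (X i j))\<^sup>2)" by (simp add: sum_nonneg)
  have B: "real (X i j) \<le> B" if "i < n" for i
    unfolding B_def using that
    by (intro real_le_rsqrt member_le_sum[where f="\<lambda>i. (real (X i j))\<^sup>2"]) auto
  have g: "(erm d n X j x - b j x)\<^sup>2 \<le> (\<Sum>i<n. (real (X i j))\<^sup>2) + (b j x)\<^sup>2" for x
  proof -
    have r: "0 \<le> erm d n X j x" "erm d n X j x \<le> B"
      using erm_range[where n=n and X=X and d=d, OF X n j _ B] S by (auto simp: B_def)
    then have "(erm d n X j x)\<^sup>2 \<le> B\<^sup>2" by (intro power_mono) auto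
    also have "B\<^sup>2 = (\<Sum>i<n. (real (X i j))\<^sup>2)" using S by (simp add: B_def)
    moreover have "0 \<le> erm d n X j x * b j x" using r b_nonneg by simp
    ultimately show ?thesis by (simp add: power2_diff)
  qed
  have "Q n j X \<le> (\<integral>\<^sup>+x. ennreal ((\<Sum>i<n. (real (X i j))\<^sup>2) + (b j x)\<^sup>2) \<partial>q)"
    unfolding Q_def by (intro nn_integral_mono ennreal_leI g)
  also have "\<dots> = ennreal (\<Sum>i<n. (real (X i j))\<^sup>2) + (\<integral>\<^sup>+x. ennreal ((b j x)\<^sup>2) \<partial>q)"
    using S by (simp add: nn_integral_add measure_pmf.emeasure_space_1)
  also have "ennreal (\<Sum>i<n. (real (X i j))\<^sup>2) = (\<Sum>i<n. ennreal ((real (X i j))\<^sup>2))"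
    by (intro sum_ennreal[symmetric]) auto
  finally show ?thesis .
qed

lemma prob_bad_sample:
  "measure_pmf.prob (sample n) {X. \<exists>i<n. X i \<in> A} \<le> real n * measure_pmf.prob q A"
proof -
  have "measure_pmf.prob (sample n) {X. \<exists>i<n. X i \<in> A} = measure_pmf.prob (sample n) (\<Union>i\<in>{..<n}. {X. X i \<in> A})"
    by (intro arg_cong[where f="measure_pmf.prob (sample n)"]) auto
  also have "\<dots> \<le> (\<Sum>i<n. measure_pmf.prob (sample n) {X. X i \<in> A})"
    by (intro measure_pmf.finite_measure_subadditive_finite) auto
  also have "\<dots> = (\<Sum>i<n. measure_pmf.prob q A)"
  proof (rule sum.cong[OF refl])
    fix i assume "i \<in> {..<n}"
    then have "map_pmf (\<lambda>X. X i) (sample n) = q" by (simp add: sample_def Pi_pmf_component)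
    then have "measure_pmf.prob q A = measure_pmf.prob (map_pmf (\<lambda>X. X i) (sample n)) A" by simp
    also have "\<dots> = measure_pmf.prob (sample n) {X. X i \<in> A}" by (simp add: vimage_def)
    finally show "measure_pmf.prob (sample n) {X. X i \<in> A} = measure_pmf.prob q A" ..
  qed
  finally show ?thesis by simp
qed

text \<open>Up to powers of \<open>n\<close>, each remainder is a second moment on a rare event, and
  \<open>sq_tail_bound\<close> brings it to the common form
  \<open>t = M / B\<^sup>2 + B\<^sup>2\<close>. Together they amount to
  \<open>B\<^sup>2 + t / 2 + t\<close>, hence at most \<open>3 * t\<close>.\<close>

lemma Q_expectation_le:
  assumes j: "j < d" and n: "n > 0" and K: "real K \<le> B" and L: "L \<le> B" and B: "B \<ge> 1"
    and M: "M \<ge> 0" "(\<integral>\<^sup>+x. ennreal ((real (x j))^4) \<partial>q) \<le> ennreal M"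
      "(\<integral>\<^sup>+x. ennreal ((b j x)^4) \<partial>q) \<le> ennreal M"
    and \<delta>: "measure_pmf.prob q (- good j K L) \<le> 1 / real n ^ 5"
  shows "ennreal (real n) * (\<integral>\<^sup>+X. Q n j X \<partial>sample n) \<le>
    ennreal ((\<Sum>x\<in>good j K L. cell_bound n j B x) + 3 * (M / B\<^sup>2 + B\<^sup>2))"
proof -
  let ?G = "good j K L"
  define bad where "bad = {X. \<exists>i<n. X i \<in> - ?G}"
  define F2 where "F2 = (\<integral>\<^sup>+x. ennreal ((b j x)\<^sup>2) \<partial>q)"
  define T where "T = (\<integral>\<^sup>+x. ennreal ((real K)\<^sup>2 + (b j x)\<^sup>2) * indicator (- ?G) x \<partial>q)"
  define t where "t = M / B\<^sup>2 + B\<^sup>2"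
  have n1: "real n \<ge> 1" using n by simp
  have t: "t \<ge> 0" using M by (simp add: t_def)
  have n5: "1 / real n ^ 5 \<le> 1 / real n ^ k" if "k \<le> 5" for k
    using n1 that by (intro divide_left_mono power_increasing mult_pos_pos) auto
  have P: "measure_pmf.prob (sample n) bad \<le> 1 / real n ^ 4"
  proof -
    have "measure_pmf.prob (sample n) bad \<le> real n * (1 / real n ^ 5)"
      unfolding bad_def using prob_bad_sample[of n "- ?G"] mult_left_mono[OF \<delta>, of "real n"] by linarith
    also have "\<dots> = 1 / real n ^ 4" using n by (simp add: power_numeral_reduce)
    finally show ?thesis .
  qed
  have F2: "F2 \<le> ennreal (t / 2)"
  proof -
    have "F2 \<le> ennreal ((1 / B\<^sup>2 * M + 1 / (1 / B\<^sup>2)) / 2)"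
      using sq_tail_bound[OF M(3,1), of UNIV 1 "1 / B\<^sup>2"] B by (simp add: F2_def)
    then show ?thesis by (simp add: t_def)
  qed
  have T: "ennreal (real n) * T \<le> ennreal (B\<^sup>2 + t / 2)"
  proof -
    have "(\<integral>\<^sup>+x. ennreal ((b j x)\<^sup>2) * indicator (- ?G) x \<partial>q) \<le>
        ennreal ((1 / (real n * B\<^sup>2) * M + (1 / real n ^ 5) / (1 / (real n * B\<^sup>2))) / 2)"
      using sq_tail_bound[OF M(3,1) \<delta>, of "1 / (real n * B\<^sup>2)"] B n by simp
    also have "\<dots> \<le> ennreal (t / (2 * real n))"
    proof (rule ennreal_leI)
      have "(1 / real n ^ 5) / (1 / (real n * B\<^sup>2)) \<le> (1 / real n ^ 2) / (1 / (real n * B\<^sup>2))"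
        using n5[of 2] B n by (intro divide_right_mono) auto
      also have "\<dots> = B\<^sup>2 / real n" using n B by (simp add: field_simps power2_eq_square)
      finally have "(1 / (real n * B\<^sup>2) * M + (1 / real n ^ 5) / (1 / (real n * B\<^sup>2))) / 2 \<le>
        (1 / (real n * B\<^sup>2) * M + B\<^sup>2 / real n) / 2"
        by (intro divide_right_mono add_left_mono) auto
      also have "\<dots> = t / (2 * real n)" using n B by (simp add: t_def field_simps)
      finally show "(1 / (real n * B\<^sup>2) * M + (1 / real n ^ 5) / (1 / (real n * B\<^sup>2))) / 2 \<le> t / (2 * real n)" .
    qed
    finally have 1: "(\<integral>\<^sup>+x. ennreal ((b j x)\<^sup>2) * indicator (- ?G) x \<partial>q) \<le> ennreal (t / (2 * real n))" .
    have "T = (\<integral>\<^sup>+x. ennreal ((real K)\<^sup>2) * indicator (- ?G) x + ennreal ((b j x)\<^sup>2) * indicator (- ?G) x \<partial>q)"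
      unfolding T_def by (intro nn_integral_cong) (auto simp: indicator_def)
    also have "\<dots> = ennreal ((real K)\<^sup>2) * emeasure q (- ?G) + (\<integral>\<^sup>+x. ennreal ((b j x)\<^sup>2) * indicator (- ?G) x \<partial>q)"
      by (simp add: nn_integral_add nn_integral_cmult)
    also have "\<dots> \<le> ennreal (B\<^sup>2) * ennreal (1 / real n ^ 1) + ennreal (t / (2 * real n))"
    proof (intro add_mono mult_mono 1)
      show "ennreal ((real K)\<^sup>2) \<le> ennreal (B\<^sup>2)" using K by (intro ennreal_leI power_mono) auto
      show "emeasure q (- ?G) \<le> ennreal (1 / real n ^ 1)"
        unfolding measure_pmf.emeasure_eq_measure using \<delta> n5[of 1] by (intro ennreal_leI) linarith
    qed auto
    also have "\<dots> = ennreal (B\<^sup>2 / real n + t / (2 * real n))"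
      using t by (subst ennreal_plus) (auto simp: ennreal_mult[symmetric])
    finally have "ennreal (real n) * T \<le> ennreal (real n) * ennreal (B\<^sup>2 / real n + t / (2 * real n))"
      by (rule mult_left_mono) simp
    also have "\<dots> = ennreal (B\<^sup>2 + t / 2)"
      using n t by (subst ennreal_mult[symmetric]) (auto simp: distrib_left)
    finally show ?thesis .
  qed
  have S: "(\<integral>\<^sup>+X. ennreal ((real (X i j))\<^sup>2) * indicator bad X \<partial>sample n) \<le> ennreal (t / (2 * real n ^ 2))" if i: "i < n" for i
  proof -
    have "(\<integral>\<^sup>+X. ennreal ((real (X i j))^4) \<partial>sample n) \<le> ennreal M"
      using nn_integral_Pi_pmf_component[of "{..<n}" i undefined q "\<lambda>x. ennreal ((real (x j))^4)"] i M(2)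
      by (simp add: sample_def)
    \<comment> \<open>With \<open>\<delta> = 1 / n ^ 4\<close> this parameter yields
      \<open>t / (2 * n ^ 2)\<close>; the sum over \<open>n\<close> observations and the outer
      factor \<open>n\<close> absorb exactly \<open>n ^ 2\<close>.\<close>
    from sq_tail_bound[OF this M(1) P, of "1 / (real n ^ 2 * B\<^sup>2)"]
    have "(\<integral>\<^sup>+X. ennreal ((real (X i j))\<^sup>2) * indicator bad X \<partial>sample n) \<le>
        ennreal ((1 / (real n ^ 2 * B\<^sup>2) * M + (1 / real n ^ 4) / (1 / (real n ^ 2 * B\<^sup>2))) / 2)"
      using B n by simp
    also have "(1 / (real n ^ 2 * B\<^sup>2) * M + (1 / real n ^ 4) / (1 / (real n ^ 2 * B\<^sup>2))) / 2 = t / (2 * real n ^ 2)"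
      using n B by (simp add: t_def field_simps power2_eq_square power4_eq_xxxx)
    finally show ?thesis .
  qed
  have lin: "(\<integral>\<^sup>+X. (\<Sum>x\<in>?G. u X x) + c + c' * ((\<Sum>i<n. v i X) + c'' * indicator bad X) \<partial>sample n) =
      (\<Sum>x\<in>?G. \<integral>\<^sup>+X. u X x \<partial>sample n) + c +
      c' * ((\<Sum>i<n. \<integral>\<^sup>+X. v i X \<partial>sample n) + c'' * emeasure (sample n) bad)"
    for u :: "(nat \<Rightarrow> nat \<Rightarrow> nat) \<Rightarrow> (nat \<Rightarrow> nat) \<Rightarrow> ennreal" and v c c' c''
    by (simp add: nn_integral_add nn_integral_cmult nn_integral_sum measure_pmf.emeasure_space_1)
  have "ennreal (real n) * Q n j X \<le> (\<Sum>x\<in>?G. ennreal (cell_error n j B X x)) + ennreal (real n) * T +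
      ennreal (real n) * ((\<Sum>i<n. ennreal ((real (X i j))\<^sup>2) * indicator bad X) + F2 * indicator bad X)"
    if "X \<in> set_pmf (sample n)" for X
  proof (cases "X \<in> bad")
    case True
    have "\<And>i. i < n \<Longrightarrow> X i \<in> Zd d" using set_sample[OF that] set_q by blast
    from Q_any_sample[OF j n this] have "Q n j X \<le> (\<Sum>i<n. ennreal ((real (X i j))\<^sup>2)) + F2"
      by (simp add: F2_def)
    then have "ennreal (real n) * Q n j X \<le> ennreal (real n) * ((\<Sum>i<n. ennreal ((real (X i j))\<^sup>2)) + F2)"
      by (rule mult_left_mono) simp
    then show ?thesis using True by (simp add: add_increasing)
  next
    case False
    then have "\<And>i. i < n \<Longrightarrow> X i \<in> ?G" by (auto simp: bad_def)
    from Q_good_sample[OF j n K L this] False show ?thesis by (simp add: T_def)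
  qed
  then have "(\<integral>\<^sup>+X. ennreal (real n) * Q n j X \<partial>sample n) \<le> (\<integral>\<^sup>+X. (\<Sum>x\<in>?G. ennreal (cell_error n j B X x)) + ennreal (real n) * T +
      ennreal (real n) * ((\<Sum>i<n. ennreal ((real (X i j))\<^sup>2) * indicator bad X) + F2 * indicator bad X) \<partial>sample n)"
    by (intro nn_integral_mono_AE AE_pmfI)
  also have "\<dots> = (\<Sum>x\<in>?G. \<integral>\<^sup>+X. ennreal (cell_error n j B X x) \<partial>sample n) + ennreal (real n) * T +
      ennreal (real n) * ((\<Sum>i<n. \<integral>\<^sup>+X. ennreal ((real (X i j))\<^sup>2) * indicator bad X \<partial>sample n) + F2 * emeasure (sample n) bad)"
    by (rule lin)
  also have "\<dots> \<le> (\<Sum>x\<in>?G. ennreal (cell_bound n j B x)) + ennreal (B\<^sup>2 + t / 2) +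
      ennreal (real n) * ((\<Sum>i<n. ennreal (t / (2 * real n ^ 2))) + ennreal (t / 2) * ennreal (1 / real n ^ 1))"
  proof (intro add_mono mult_left_mono mult_mono sum_mono T F2 S nn_integral_cell_error[OF j n])
    have "1 / real n ^ 4 \<le> 1 / real n ^ 1"
      using n1 by (intro divide_left_mono power_increasing mult_pos_pos) auto
    then show "emeasure (sample n) bad \<le> ennreal (1 / real n ^ 1)"
      unfolding measure_pmf.emeasure_eq_measure using P by (intro ennreal_leI) linarith
  qed auto
  also have "(\<Sum>i<n. ennreal (t / (2 * real n ^ 2))) = ennreal (t / (2 * real n))"
    using n t by (subst sum_ennreal) (auto simp: field_simps power2_eq_square)
  also have "ennreal (t / 2) * ennreal (1 / real n ^ 1) = ennreal (t / (2 * real n))"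
    using t by (subst ennreal_mult[symmetric]) auto
  also have "ennreal (real n) * (ennreal (t / (2 * real n)) + ennreal (t / (2 * real n))) = ennreal t"
    using n t by (simp add: ennreal_plus[symmetric] ennreal_mult[symmetric] del: ennreal_plus)
  also have "(\<Sum>x\<in>?G. ennreal (cell_bound n j B x)) = ennreal (\<Sum>x\<in>?G. cell_bound n j B x)"
    by (intro sum_ennreal cell_bound_nonneg)
  also have "ennreal (\<Sum>x\<in>?G. cell_bound n j B x) + ennreal (B\<^sup>2 + t / 2) + ennreal t =
      ennreal ((\<Sum>x\<in>?G. cell_bound n j B x) + (B\<^sup>2 + t / 2) + t)"
    using t by (simp add: ennreal_plus[symmetric] cell_bound_nonneg sum_nonneg del: ennreal_plus)
  also have "\<dots> \<le> ennreal ((\<Sum>x\<in>?G. cell_bound n j B x) + 3 * (M / B\<^sup>2 + B\<^sup>2))"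
  proof (rule ennreal_leI)
    have "B\<^sup>2 \<le> t" using M by (simp add: t_def)
    then show "(\<Sum>x\<in>?G. cell_bound n j B x) + (B\<^sup>2 + t / 2) + t \<le>
        (\<Sum>x\<in>?G. cell_bound n j B x) + 3 * (M / B\<^sup>2 + B\<^sup>2)"
      unfolding t_def[symmetric] using t by simp
  qed
  finally show ?thesis by (simp add: nn_integral_cmult)
qed

end


section \<open>Summing the cell bounds\<close>

lemma mult_exp_neg_quarter_le: "a * exp (- (a / 4)) \<le> 4" for a :: real
proof -
  have "a / 4 \<le> exp (a / 4)" using exp_ge_add_one_self[of "a / 4"] by linarith
  then show ?thesis by (simp add: exp_minus field_simps)
qed

text \<open>Once \<open>m + 1 \<ge> 2 h\<close> the sequence at least halves in each step, so that
  \<open>a m * exp (- (a m / 4))\<close> is dominated by a telescoping difference.\<close>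

lemma sum_mult_exp_neg_le:
  fixes a :: "nat \<Rightarrow> real"
  assumes a: "\<And>m. 0 \<le> a m" and h: "0 \<le> h" and step: "\<And>m. real (m + 1) * a (m + 1) \<le> h * a m"
  shows "(\<Sum>m\<le>K. a m * exp (- (a m / 4))) \<le> 24 * h + 8"
proof -
  let ?e = "\<lambda>m. exp (- (a m / 4))"
  \<comment> \<open>Beyond \<open>2 * h\<close>, halving gives
    \<open>a m \<le> 8 * (a m / 4 - a (m + 1) / 4)\<close>, whence the 8. Before it,
    \<open>12 = 4 + 8\<close> covers the maximal term and a difference as low as
    \<open>- 1\<close>.\<close>
  have "a m * ?e m \<le> 12 * (if m < nat \<lfloor>2 * h\<rfloor> then 1 else 0) + 8 * (?e (Suc m) - ?e m)" for m
  proof (cases "m < nat \<lfloor>2 * h\<rfloor>")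
    case True
    have "?e m \<le> 1" "0 \<le> ?e (Suc m)" using a[of m] by auto
    then have "- 1 \<le> ?e (Suc m) - ?e m" by linarith
    with mult_exp_neg_quarter_le[of "a m"] True show ?thesis by simp
  next
    case False
    then have "2 * h \<le> real (m + 1)" using h by linarith
    then have "2 * h * a (m + 1) \<le> h * a m"
      using step[of m] a[of "m + 1"] mult_right_mono[of "2 * h" "real (m + 1)" "a (m + 1)"] by linarith
    have half: "2 * a (m + 1) \<le> a m"
    proof (cases "h = 0")
      case True
      then show ?thesis using step[of m] a[of m] a[of "m + 1"]
        by (simp add: mult_le_0_iff)
    next
      case False
      with \<open>2 * h * a (m + 1) \<le> h * a m\<close> h show ?thesis by (simp add: mult.assoc mult.left_commute)
    qed
    have "a m * ?e m \<le> 8 * (a m / 4 - a (m + 1) / 4) * ?e m"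
      using half by (intro mult_right_mono) auto
    also have "\<dots> \<le> 8 * (?e (m + 1) - ?e m)"
    proof -
      have "?e m * (1 + (a m / 4 - a (m + 1) / 4)) \<le> ?e m * exp (a m / 4 - a (m + 1) / 4)"
        by (intro mult_left_mono exp_ge_add_one_self) auto
      also have "\<dots> = ?e (m + 1)" by (simp add: mult_exp_exp)
      finally show ?thesis by (simp add: algebra_simps)
    qed
    finally show ?thesis using False by simp
  qed
  then have "(\<Sum>m\<le>K. a m * ?e m) \<le> (\<Sum>m\<le>K. 12 * (if m < nat \<lfloor>2 * h\<rfloor> then 1 else 0) + 8 * (?e (Suc m) - ?e m))"
    by (rule sum_mono)
  also have "\<dots> = 12 * real (card ({..K} \<inter> {..<nat \<lfloor>2 * h\<rfloor>})) + 8 * (?e (Suc K) - ?e 0)"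
    using sum_lessThan_telescope[of ?e "Suc K"]
    by (simp only: sum.distrib sum_distrib_left[symmetric] lessThan_Suc_atMost)
      (simp add: sum.If_cases lessThan_def)
  also have "\<dots> \<le> 12 * real (nat \<lfloor>2 * h\<rfloor>) + 8 * 1"
  proof (intro add_mono mult_left_mono)
    have "card ({..K} \<inter> {..<nat \<lfloor>2 * h\<rfloor>}) \<le> card {..<nat \<lfloor>2 * h\<rfloor>}" by (rule card_mono) auto
    then show "real (card ({..K} \<inter> {..<nat \<lfloor>2 * h\<rfloor>})) \<le> real (nat \<lfloor>2 * h\<rfloor>)" by simp
    have "?e (Suc K) \<le> 1" "0 \<le> ?e 0" using a[of "Suc K"] by auto
    then show "?e (Suc K) - ?e 0 \<le> 1" by linarith
  qed auto
  also have "\<dots> \<le> 24 * h + 8" using h of_int_floor_le[of "2 * h"] by simp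
  finally show ?thesis .
qed

context poisson_mixture
begin

lemma card_good_le: "real (card (good j K L)) \<le> real (K + 1) ^ d"
proof -
  have "card (good j K L) \<le> card (PiE_dflt {..<d} 0 (\<lambda>_. {..K}))"
    unfolding box_eq[symmetric] by (rule card_mono[OF finite_box]) (auto simp: good_def)
  also have "\<dots> = (K + 1) ^ d" by (simp add: card_PiE_dflt)
  finally have "real (card (good j K L)) \<le> real ((K + 1) ^ d)" by (rule of_nat_mono)
  then show ?thesis by simp
qed

text \<open>The box consists of \<open>(K + 1) ^ (d - 1)\<close> lines in direction
  \<open>j\<close>, indexed by their points with \<open>j\<close>-th coordinate 0. A line sum
  bounded independently of \<open>K\<close> thus saves one factor \<open>K + 1\<close>.\<close>

lemma sum_good_lines_le:
  assumes j: "j < d" and \<phi>: "\<And>x. 0 \<le> \<phi> x" and c: "\<And>y. (\<Sum>m\<le>K. \<phi> (y(j := m))) \<le> c"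
  shows "(\<Sum>x\<in>good j K L. \<phi> x) \<le> real (K + 1) ^ (d - 1) * (c :: real)"
proof -
  define D where "D = PiE_dflt ({..<d} - {j}) 0 (\<lambda>_. {..K})"
  have fin: "finite D" unfolding D_def by (rule finite_PiE_dflt) auto
  have "good j K L \<subseteq> (\<lambda>(y, m). y(j := m)) ` (D \<times> {..K})"
  proof
    fix x assume x: "x \<in> good j K L"
    have "x = (\<lambda>(y, m). y(j := m)) (x(j := 0), x j)" by auto
    moreover have "(x(j := 0), x j) \<in> D \<times> {..K}"
      using x j by (auto simp: D_def PiE_dflt_def good_def Zd_def)
    ultimately show "x \<in> (\<lambda>(y, m). y(j := m)) ` (D \<times> {..K})" by (rule image_eqI)
  qed
  then have "(\<Sum>x\<in>good j K L. \<phi> x) \<le> (\<Sum>x\<in>(\<lambda>(y, m). y(j := m)) ` (D \<times> {..K}). \<phi> x)"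
    using fin \<phi> by (intro sum_mono2) auto
  also have "\<dots> \<le> (\<Sum>z\<in>D \<times> {..K}. (\<phi> \<circ> (\<lambda>(y, m). y(j := m))) z)"
    using fin \<phi> by (intro sum_image_le) auto
  also have "\<dots> = (\<Sum>y\<in>D. \<Sum>m\<le>K. \<phi> (y(j := m)))"
    by (simp add: sum.cartesian_product case_prod_unfold comp_def)
  also have "\<dots> \<le> (\<Sum>y\<in>D. c)" by (intro sum_mono c)
  also have "\<dots> = real (K + 1) ^ (d - 1) * c"
    using j by (simp add: D_def card_PiE_dflt)
  finally show ?thesis .
qed

text \<open>Along each line \<open>p_b\<close> with \<open>b \<le> h\<close> provides the decay
  required by \<open>sum_mult_exp_neg_le\<close>. The variance part contributes 32 and the
  exponential part \<open>2 * 32\<close>, as \<open>24 * h + 8 \<le> 32 * H\<close>.\<close>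

lemma sum_cell_bound_bounded:
  assumes j: "j < d" and h: "0 \<le> h" "h \<le> H" "1 \<le> H" "h \<le> real (K + 1)" and b: "\<And>x. b j x \<le> h"
  shows "(\<Sum>x\<in>good j K h. cell_bound n j (real (K + 1)) x) \<le> 96 * H * real (K + 1) ^ (d + 1)"
proof -
  define B where "B = real (K + 1)"
  have B: "B \<ge> 1" "h \<le> B" using h by (auto simp: B_def)
  have lines: "(\<Sum>m\<le>K. real n * p (y(j := m)) * exp (- (real n * p (y(j := m)) / 4))) \<le> 24 * h + 8" for y
  proof (rule sum_mult_exp_neg_le)
    fix m
    have "real (m + 1) * p (y(j := m + 1)) = p (y(j := m)) * b j (y(j := m))"
      using p_b[OF j, of "y(j := m)"] by simp
    also have "\<dots> \<le> p (y(j := m)) * h" by (intro mult_left_mono b p_nonneg)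
    finally show "real (m + 1) * (real n * p (y(j := m + 1))) \<le> h * (real n * p (y(j := m)))"
      using mult_left_mono[of "real (m + 1) * p (y(j := m + 1))" "p (y(j := m)) * h" "real n"]
      by (simp add: mult_ac)
  qed (use p_nonneg h in auto)
  have "(\<Sum>x\<in>good j K h. cell_bound n j B x) = (\<Sum>x\<in>good j K h. 16 * b j x * (real (x j + 1) + b j x)) +
      2 * B\<^sup>2 * (\<Sum>x\<in>good j K h. real n * p x * exp (- (real n * p x / 4)))"
    unfolding cell_bound_def by (simp add: sum.distrib sum_distrib_left)
  also have "\<dots> \<le> B ^ d * (16 * H * (2 * B)) + 2 * B\<^sup>2 * (B ^ (d - 1) * (32 * H))"
  proof (intro add_mono mult_left_mono)
    have "(\<Sum>x\<in>good j K h. 16 * b j x * (real (x j + 1) + b j x)) \<le> (\<Sum>x\<in>good j K h. 16 * H * (2 * B))"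
    proof (rule sum_mono)
      fix x assume x: "x \<in> good j K h"
      have "real (x j + 1) \<le> B" using x j by (auto simp: good_def B_def)
      then show "16 * b j x * (real (x j + 1) + b j x) \<le> 16 * H * (2 * B)"
        using b[of x] b_nonneg[of j x] h B by (intro mult_mono) auto
    qed
    also have "\<dots> = real (card (good j K h)) * (16 * H * (2 * B))" by simp
    also have "\<dots> \<le> B ^ d * (16 * H * (2 * B))"
      unfolding B_def using card_good_le[of j K h] h by (intro mult_right_mono) auto
    finally show "(\<Sum>x\<in>good j K h. 16 * b j x * (real (x j + 1) + b j x)) \<le> B ^ d * (16 * H * (2 * B))" .
    have "(\<Sum>x\<in>good j K h. real n * p x * exp (- (real n * p x / 4))) \<le> B ^ (d - 1) * (24 * h + 8)"
      unfolding B_def by (rule sum_good_lines_le[OF j _ lines]) (use p_nonneg in auto)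
    also have "\<dots> \<le> B ^ (d - 1) * (32 * H)" using h B by (intro mult_left_mono) auto
    finally show "(\<Sum>x\<in>good j K h. real n * p x * exp (- (real n * p x / 4))) \<le> B ^ (d - 1) * (32 * H)" .
  qed auto
  also have "\<dots> = 96 * H * B ^ (d + 1)"
    using j by (cases d) (simp_all add: power2_eq_square)
  finally show ?thesis by (simp add: B_def)
qed

lemma sum_cell_bound_le:
  assumes j: "j < d" and L: "L \<le> real (K + 1)"
  shows "(\<Sum>x\<in>good j K L. cell_bound n j (real (K + 1)) x) \<le> 40 * real (K + 1) ^ (d + 2)"
proof -
  define B where "B = real (K + 1)"
  have B: "B \<ge> 1" "L \<le> B" using L by (auto simp: B_def)
  have "(\<Sum>x\<in>good j K L. cell_bound n j B x) \<le> (\<Sum>x\<in>good j K L. 40 * B\<^sup>2)"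
  proof (rule sum_mono)
    fix x assume x: "x \<in> good j K L"
    have "real (x j + 1) \<le> B" "b j x \<le> B" using x j B by (auto simp: good_def B_def)
    then have "16 * b j x * (real (x j + 1) + b j x) \<le> 16 * B * (2 * B)"
      using b_nonneg[of j x] B by (intro mult_mono) auto
    moreover have "2 * B\<^sup>2 * (real n * p x * exp (- (real n * p x / 4))) \<le> 2 * B\<^sup>2 * 4"
      by (intro mult_left_mono mult_exp_neg_quarter_le) auto
    ultimately show "cell_bound n j B x \<le> 40 * B\<^sup>2"
      unfolding cell_bound_def by (simp add: power2_eq_square)
  qed
  also have "\<dots> = real (card (good j K L)) * (40 * B\<^sup>2)" by simp
  also have "\<dots> \<le> B ^ d * (40 * B\<^sup>2)"
    unfolding B_def using card_good_le[of j K L] by (intro mult_right_mono) auto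
  also have "\<dots> = 40 * B ^ (d + 2)" by (simp add: power_add power2_eq_square)
  finally show ?thesis by (simp add: B_def)
qed

end

section \<open>Moments and tails\<close>

lemma power4_le_exp: "t ^ 4 \<le> 256 * exp t" if "0 \<le> t" for t :: real
proof -
  have "(t / 4) ^ 4 \<le> exp (t / 4) ^ 4"
    using that exp_ge_add_one_self[of "t / 4"] by (intro power_mono) linarith+
  also have "\<dots> = exp t" by (simp add: exp_of_nat_mult[symmetric])
  finally show ?thesis by (simp add: power_divide)
qed

lemma half_le_ln_one_plus: "a / 2 \<le> ln (1 + a)" if "0 \<le> a" "a \<le> 1 / 2" for a :: real
proof -
  have "a\<^sup>2 \<le> a / 2" using that mult_left_mono[of a "1/2" a] by (simp add: power2_eq_square)
  with ln_one_plus_pos_lower_bound[of a] that show ?thesis by simp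
qed

lemma Markov_pmf:
  assumes m: "(\<integral>\<^sup>+x. ennreal (f x) \<partial>measure_pmf M) \<le> ennreal m" "m \<ge> 0" and c: "c > 0"
    and A: "\<And>x. x \<in> A \<Longrightarrow> c \<le> f x"
  shows "measure_pmf.prob M A \<le> m / c"
proof -
  have "ennreal (c * measure_pmf.prob M A) = (\<integral>\<^sup>+x. ennreal c * indicator A x \<partial>M)"
    using c by (simp add: nn_integral_cmult measure_pmf.emeasure_eq_measure ennreal_mult)
  also have "\<dots> \<le> (\<integral>\<^sup>+x. ennreal (f x) \<partial>M)"
    using A by (intro nn_integral_mono) (auto simp: indicator_def intro: ennreal_leI)
  also have "\<dots> \<le> ennreal m" by (rule m)
  finally have "c * measure_pmf.prob M A \<le> m" using m(2) by simp
  then show ?thesis using c by (simp add: field_simps)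
qed

context poisson_mixture
begin

text \<open>One exponential moment of the prior controls everything: \<open>X\<close> through the
  generating function at \<open>1 + 1 / (2 * S)\<close>, and \<open>b\<close> through
  Jensen.\<close>

lemma moment_bounds:
  assumes S: "S \<ge> 1" and j: "j < d"
    and E: "(\<integral>\<^sup>+\<theta>. ennreal (exp (1 / (2 * S) * \<theta> j)) \<partial>\<pi>) \<le> 9"
  shows "(\<integral>\<^sup>+x. ennreal ((real (x j))^4) \<partial>q) \<le> ennreal (600000 * S ^ 4)"
    and "(\<integral>\<^sup>+x. ennreal ((b j x)^4) \<partial>q) \<le> ennreal (600000 * S ^ 4)"
    and "(\<integral>\<^sup>+x. ennreal ((1 + 1 / (2 * S)) ^ x j) \<partial>q) \<le> 9"
    and "(\<integral>\<^sup>+x. ennreal (exp (1 / (2 * S) * b j x)) \<partial>q) \<le> 9"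
    and "(\<integral>\<^sup>+\<theta>. ennreal ((\<theta> j)\<^sup>2) \<partial>\<pi>) < \<infinity>"
proof -
  define a where "a = 1 / (2 * S)"
  have a: "0 < a" "a \<le> 1 / 2" "a * S = 1 / 2" using S by (auto simp: a_def divide_simps)
  show z: "(\<integral>\<^sup>+x. ennreal ((1 + 1 / (2 * S)) ^ x j) \<partial>q) \<le> 9"
    using nn_integral_power_q[OF j, of "1 + 1 / (2 * S)"] E S by (simp add: mult.commute)
  show bE: "(\<integral>\<^sup>+x. ennreal (exp (1 / (2 * S) * b j x)) \<partial>q) \<le> 9"
    using b_jensen[OF j, of "1 / (2 * S)"] E by (rule order_trans)
  have S4: "0 \<le> S ^ 4" using S by simp
  have scale: "(\<integral>\<^sup>+x. ennreal (f x) \<partial>q) \<le> ennreal (600000 * S ^ 4)"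
    if f: "\<And>x. f x \<le> 65536 * S ^ 4 * g x" and g: "(\<integral>\<^sup>+x. ennreal (g x) \<partial>q) \<le> 9" "\<And>x. 0 \<le> g x"
    for f g :: "(nat \<Rightarrow> nat) \<Rightarrow> real"
  proof -
    have "(\<integral>\<^sup>+x. ennreal (f x) \<partial>q) \<le> (\<integral>\<^sup>+x. ennreal (65536 * S ^ 4) * ennreal (g x) \<partial>q)"
      using f g(2) S4 by (intro nn_integral_mono) (auto simp: ennreal_mult[symmetric] intro: ennreal_leI)
    also have "\<dots> = ennreal (65536 * S ^ 4) * (\<integral>\<^sup>+x. ennreal (g x) \<partial>q)" by (rule nn_integral_cmult) simp
    also have "\<dots> \<le> ennreal (65536 * S ^ 4) * ennreal 9" using g(1) by (intro mult_left_mono) auto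
    also have "\<dots> = ennreal (65536 * S ^ 4 * 9)" using S4 by (intro ennreal_mult[symmetric]) auto
    also have "\<dots> \<le> ennreal (600000 * S ^ 4)" using S4 by (intro ennreal_leI) simp
    finally show ?thesis .
  qed
  \<comment> \<open>Half the rate \<open>a\<close> is used because \<open>ln (1 + a)\<close> is only
    bounded below by \<open>a / 2\<close>. Rescaling by \<open>4 * S\<close> and
    \<open>power4_le_exp\<close> each give a factor 256, and
    \<open>9 * 65536 < 600000\<close>.\<close>
  have aux: "t ^ 4 \<le> 65536 * S ^ 4 * exp u" if "0 \<le> t" "t * a / 2 \<le> u" for t u
  proof -
    have "t ^ 4 = 256 * S ^ 4 * (t * a / 2) ^ 4"
      using S by (simp add: a_def power_divide power_mult_distrib)
    also have "\<dots> \<le> 256 * S ^ 4 * (256 * exp (t * a / 2))"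
      using that a S4 by (intro mult_left_mono power4_le_exp) auto
    also have "\<dots> \<le> 256 * S ^ 4 * (256 * exp u)"
      using that S4 by (intro mult_left_mono) auto
    finally show ?thesis by simp
  qed
  show "(\<integral>\<^sup>+x. ennreal ((real (x j))^4) \<partial>q) \<le> ennreal (600000 * S ^ 4)"
  proof (rule scale[OF _ z])
    fix x :: "nat \<Rightarrow> nat"
    have "real (x j) * a / 2 \<le> real (x j) * ln (1 + a)"
      using mult_left_mono[OF half_le_ln_one_plus[of a], of "real (x j)"] a by simp
    from aux[OF _ this] have "real (x j) ^ 4 \<le> 65536 * S ^ 4 * exp (real (x j) * ln (1 + a))" by simp
    also have "exp (real (x j) * ln (1 + a)) = (1 + a) ^ x j"
      using a by (simp add: exp_of_nat_mult)
    finally show "real (x j) ^ 4 \<le> 65536 * S ^ 4 * (1 + 1 / (2 * S)) ^ x j" by (simp add: a_def)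
  qed (use S in auto)
  show "(\<integral>\<^sup>+x. ennreal ((b j x)^4) \<partial>q) \<le> ennreal (600000 * S ^ 4)"
  proof (rule scale[OF _ bE])
    fix x
    have "b j x * a / 2 \<le> a * b j x" using b_nonneg[of j x] a by simp
    from aux[OF b_nonneg this] show "b j x ^ 4 \<le> 65536 * S ^ 4 * exp (1 / (2 * S) * b j x)"
      by (simp add: a_def)
  qed auto
  have "(\<integral>\<^sup>+\<theta>. ennreal ((\<theta> j)\<^sup>2) \<partial>\<pi>) \<le> (\<integral>\<^sup>+\<theta>. ennreal (1 + 65536 * S ^ 4 * exp (1 / (2 * S) * \<theta> j)) \<partial>\<pi>)"
  proof (rule nn_integral_mono_AE, use AE_nonneg'[OF j] in eventually_elim)
    fix \<theta> :: "nat \<Rightarrow> real" assume \<theta>: "0 \<le> \<theta> j"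
    have "0 \<le> ((\<theta> j)\<^sup>2 - 1)\<^sup>2" by simp
    then have "(\<theta> j)\<^sup>2 \<le> 1 + (\<theta> j) ^ 4"
      by (simp add: power2_eq_square power4_eq_xxxx algebra_simps) (use zero_le_square[of "\<theta> j"] in linarith)
    moreover have "(\<theta> j) ^ 4 \<le> 65536 * S ^ 4 * exp (1 / (2 * S) * \<theta> j)"
      unfolding a_def[symmetric] using \<theta> a by (intro aux) (auto simp: mult.commute)
    ultimately show "ennreal ((\<theta> j)\<^sup>2) \<le> ennreal (1 + 65536 * S ^ 4 * exp (1 / (2 * S) * \<theta> j))"
      by (intro ennreal_leI) linarith
  qed
  also have "\<dots> = (\<integral>\<^sup>+\<theta>. 1 + ennreal (65536 * S ^ 4) * ennreal (exp (1 / (2 * S) * \<theta> j)) \<partial>\<pi>)"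
    using S4 by (intro nn_integral_cong) (simp add: ennreal_mult)
  also have "\<dots> = 1 + ennreal (65536 * S ^ 4) * (\<integral>\<^sup>+\<theta>. ennreal (exp (1 / (2 * S) * \<theta> j)) \<partial>\<pi>)"
    using j by (simp add: nn_integral_add nn_integral_cmult emeasure_space_1)
  also have "\<dots> \<le> 1 + ennreal (65536 * S ^ 4) * 9"
    using E by (intro add_mono mult_left_mono) auto
  also have "\<dots> < \<infinity>" by (simp add: ennreal_mult_less_top)
  finally show "(\<integral>\<^sup>+\<theta>. ennreal ((\<theta> j)\<^sup>2) \<partial>\<pi>) < \<infinity>" .
qed

text \<open>A union bound over \<open>d + 1\<close> events; here \<open>d \<le> n\<close> and
  \<open>n \<ge> 3\<close> enter through \<open>d + 1 \<le> n\<^sup>2\<close>, costing two powers of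
  \<open>n\<close>. Cells of mass zero contribute nothing.\<close>

lemma prob_not_good_le:
  assumes j: "j < d" and n: "max d 3 \<le> n"
    and K: "\<And>k. k < d \<Longrightarrow> measure_pmf.prob q {x. x k > K} \<le> 1 / real n ^ 7"
    and L: "measure_pmf.prob q {x. b j x > L} \<le> 1 / real n ^ 7"
  shows "measure_pmf.prob q (- good j K L) \<le> 1 / real n ^ 5"
proof -
  let ?U = "(\<Union>k\<in>{..<d}. {x. x k > K})"
  have "measure_pmf.prob q (- good j K L) \<le> measure_pmf.prob q (?U \<union> {x. b j x > L})"
    by (rule measure_pmf.finite_measure_mono_AE)
      (auto simp: AE_measure_pmf_iff good_def set_q not_le)
  also have "\<dots> \<le> measure_pmf.prob q ?U + measure_pmf.prob q {x. b j x > L}"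
    by (rule measure_Un_le) auto
  also have "measure_pmf.prob q ?U \<le> (\<Sum>k<d. measure_pmf.prob q {x. x k > K})"
    by (rule measure_pmf.finite_measure_subadditive_finite) auto
  also have "\<dots> \<le> (\<Sum>k<d. 1 / real n ^ 7)" by (intro sum_mono K) auto
  finally have "measure_pmf.prob q (- good j K L) \<le> (real d + 1) / real n ^ 7"
    using L by (simp add: add_divide_distrib)
  also have "\<dots> \<le> (real n * real n) / real n ^ 7"
  proof (rule divide_right_mono)
    have "real d + 1 \<le> real n * 2" using n by simp
    also have "\<dots> \<le> real n * real n" using n by (intro mult_left_mono) auto
    finally show "real d + 1 \<le> real n * real n" .
  qed simp
  also have "\<dots> = 1 / real n ^ 5"
    using n by (simp add: power_numeral_reduce)
  finally show ?thesis .
qed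

text \<open>The common end of both cases. Since \<open>S \<le> K + 1\<close>, the moment remainder
  is also at most a multiple of \<open>V\<close>, and \<open>96 + 3 * 600001\<close> stays below the
  constant 2000000.\<close>

lemma regret_erm_le:
  assumes d: "1 \<le> d" and n: "max d 3 \<le> n" and S: "S \<ge> 1" "S \<le> real (K + 1)" and L: "L \<le> real (K + 1)"
    and E: "\<And>j. j < d \<Longrightarrow> (\<integral>\<^sup>+\<theta>. ennreal (exp (1 / (2 * S) * \<theta> j)) \<partial>\<pi>) \<le> 9"
    and K: "\<And>k. k < d \<Longrightarrow> measure_pmf.prob q {x. x k > K} \<le> 1 / real n ^ 7"
    and L': "\<And>j. j < d \<Longrightarrow> measure_pmf.prob q {x. b j x > L} \<le> 1 / real n ^ 7"
    and V: "\<And>j. j < d \<Longrightarrow> (\<Sum>x\<in>good j K L. cell_bound n j (real (K + 1)) x) \<le> 96 * V"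
    and V': "real (K + 1) ^ 2 \<le> V"
  shows "regret_erm d n \<pi> \<le> ereal (2000000 * real d / real n * V)"
proof -
  define B where "B = real (K + 1)"
  have B: "B \<ge> 1" by (simp add: B_def)
  have n0: "n > 0" using n by simp
  have V0: "V \<ge> 0" using V' by (meson zero_le_power2 order_trans)
  have Q: "(\<integral>\<^sup>+X. Q n j X \<partial>sample n) \<le> ennreal (2000000 * V / real n)" if j: "j < d" for j
  proof -
    have "ennreal (real n) * (\<integral>\<^sup>+X. Q n j X \<partial>sample n) \<le>
      ennreal ((\<Sum>x\<in>good j K L. cell_bound n j B x) + 3 * (600000 * S ^ 4 / B\<^sup>2 + B\<^sup>2))"
      using S B L n0
      by (intro Q_expectation_le[OF j] moment_bounds[OF S(1) j E[OF j]] prob_not_good_le[OF j n K L'[OF j]])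
        (auto simp: B_def)
    also have "\<dots> \<le> ennreal (2000000 * V)"
    proof (rule ennreal_leI)
      have "S ^ 4 \<le> B ^ 4" using S by (intro power_mono) (auto simp: B_def)
      then have "S ^ 4 / B\<^sup>2 \<le> B ^ 4 / B\<^sup>2" by (intro divide_right_mono) auto
      also have "\<dots> = B\<^sup>2" using B by (simp add: power2_eq_square power4_eq_xxxx)
      also have "\<dots> \<le> V" using V' by (simp add: B_def)
      finally show "(\<Sum>x\<in>good j K L. cell_bound n j B x) + 3 * (600000 * S ^ 4 / B\<^sup>2 + B\<^sup>2) \<le> 2000000 * V"
        using V[OF j] V' V0 by (simp add: B_def)
    qed
    finally have "ennreal (real n) * (\<integral>\<^sup>+X. Q n j X \<partial>sample n) \<le> ennreal (2000000 * V)" .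
    then have "ennreal (1 / real n) * (ennreal (real n) * (\<integral>\<^sup>+X. Q n j X \<partial>sample n)) \<le> ennreal (1 / real n) * ennreal (2000000 * V)"
      by (rule mult_left_mono) simp
    also have "ennreal (1 / real n) * (ennreal (real n) * (\<integral>\<^sup>+X. Q n j X \<partial>sample n)) = (\<integral>\<^sup>+X. Q n j X \<partial>sample n)"
      using n0 by (simp add: mult.assoc[symmetric] ennreal_mult[symmetric])
    also have "ennreal (1 / real n) * ennreal (2000000 * V) = ennreal (2000000 * V / real n)"
      using V0 by (simp add: ennreal_mult[symmetric])
    finally show ?thesis .
  qed
  have "(\<Sum>j<d. \<integral>\<^sup>+X. Q n j X \<partial>sample n) \<le> (\<Sum>j<d. ennreal (2000000 * V / real n))"
    by (intro sum_mono Q) auto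
  also have "\<dots> = ennreal (2000000 * real d / real n * V)"
    using V0 by (subst sum_ennreal) (auto simp: mult_ac)
  finally have "enn2ereal (\<Sum>j<d. \<integral>\<^sup>+X. Q n j X \<partial>sample n) \<le> enn2ereal (ennreal (2000000 * real d / real n * V))"
    by (simp add: less_eq_ennreal.rep_eq)
  also have "\<dots> = ereal (2000000 * real d / real n * V)"
    using V0 by (intro enn2ereal_ennreal) auto
  finally show ?thesis
    using regret_erm_eq[OF moment_bounds(5)[OF S(1) _ E]] by simp
qed

end


section \<open>Bounded and subexponential priors\<close>

lemma ln_gt_1_of_ge_3: "1 < ln (real n)" if "3 \<le> n"
proof -
  have "exp 1 < real n" using e_less_272 that by linarith
  then have "ln (exp 1) < ln (real n)" using that by (subst ln_less_cancel_iff) auto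
  then show ?thesis by simp
qed

context poisson_mixture
begin

lemma b_le:
  assumes j: "j < d" and h: "0 \<le> h" "AE \<theta> in \<pi>. \<forall>j<d. \<theta> j \<le> h"
  shows "b j x \<le> h"
proof (cases "p x = 0")
  case True
  then show ?thesis using h by (simp add: bayes_def)
next
  case False
  then have p: "p x > 0" using p_nonneg[of x] by simp
  have "p x * b j x = (\<integral>\<theta>. \<theta> j * lik d \<theta> x \<partial>\<pi>)" by (rule integral_b[OF j, symmetric])
  also have "\<dots> \<le> (\<integral>\<theta>. h * lik d \<theta> x \<partial>\<pi>)"
  proof (rule integral_mono_AE[OF moment1(1)[OF j]])
    show "integrable \<pi> (\<lambda>\<theta>. h * lik d \<theta> x)" using integrable_lik by auto
    show "AE \<theta> in \<pi>. \<theta> j * lik d \<theta> x \<le> h * lik d \<theta> x"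
      using h(2) AE_lik[of x] by eventually_elim (use j in \<open>auto intro: mult_right_mono\<close>)
  qed
  also have "\<dots> = p x * h" by (simp add: mixpmf_def)
  finally show ?thesis using p by simp
qed

lemma regret_erm_bounded:
  assumes d: "1 \<le> d" and n: "max d 3 \<le> n" and h: "AE \<theta> in \<pi>. \<forall>j<d. \<theta> j \<le> h"
  shows "regret_erm d n \<pi> \<le> ereal (2000000 * real d / real n * (max 10 (10 * h)) ^ (d + 2)
    * (ln (real n) / ln (ln (real n))) ^ (d + 1))"
proof -
  \<comment> \<open>As \<open>d \<ge> 1\<close>, some coordinate lies between 0 and \<open>h\<close>
    almost surely, which settles the sign of \<open>h\<close>.\<close>
  have "AE \<theta> in \<pi>. 0 \<le> h"
    using AE_nonneg h by eventually_elim (use d in \<open>force intro: order_trans\<close>)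
  then have h0: "0 \<le> h" by simp
  define H where "H = max 1 h"
  define l where "l = ln (real n)"
  define R where "R = l / ln l"
  \<comment> \<open>Markov at \<open>z = l\<close> bounds the tail by
    \<open>exp (H * l) / l ^ K\<close>. Since \<open>R * ln l = l\<close>, the denominator is at
    least \<open>exp (8 * H * l)\<close>, leaving \<open>n ^ -7\<close>. Rounding up and adding 1
    gives \<open>K + 1 \<le> 10 * H * R\<close>.\<close>
  define K where "K = nat \<lceil>8 * H * R\<rceil>"
  have H: "1 \<le> H" "h \<le> H" by (auto simp: H_def)
  have l: "1 < l" unfolding l_def using ln_gt_1_of_ge_3[of n] n by simp
  then have ll: "0 < ln l" by simp
  have R: "1 \<le> R" using ll ln_le_minus_one[of l] l by (simp add: R_def field_simps)
  have HR: "1 \<le> H * R" "H \<le> H * R" using H R mult_mono[of 1 H 1 R] mult_left_mono[of 1 R H] by auto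
  have K: "8 * (H * R) \<le> real K" "real (K + 1) \<le> 10 * (H * R)"
    using HR unfolding K_def by (simp_all add: mult.assoc) linarith+
  have tail: "measure_pmf.prob q {x. x k > K} \<le> 1 / real n ^ 7" if k: "k < d" for k
  proof -
    have "(\<integral>\<^sup>+x. ennreal (l ^ x k) \<partial>q) = (\<integral>\<^sup>+\<theta>. ennreal (exp (\<theta> k * (l - 1))) \<partial>\<pi>)"
      using l by (intro nn_integral_power_q[OF k]) auto
    also have "\<dots> \<le> (\<integral>\<^sup>+\<theta>. ennreal (exp (H * l)) \<partial>\<pi>)"
    proof (rule nn_integral_mono_AE, use AE_nonneg h in eventually_elim)
      fix \<theta> :: "nat \<Rightarrow> real" assume "\<forall>j<d. 0 \<le> \<theta> j" "\<forall>j<d. \<theta> j \<le> h"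
      then have "\<theta> k * (l - 1) \<le> H * l" using k l H by (intro mult_mono) force+
      then show "ennreal (exp (\<theta> k * (l - 1))) \<le> ennreal (exp (H * l))" by (intro ennreal_leI) simp
    qed
    also have "\<dots> = ennreal (exp (H * l))" by (simp add: emeasure_space_1)
    finally have "measure_pmf.prob q {x. x k > K} \<le> exp (H * l) / l ^ K"
      using l by (intro Markov_pmf[where f="\<lambda>x. l ^ x k"]) (auto intro: power_increasing)
    also have "l ^ K = exp (real K * ln l)" using l by (simp add: exp_of_nat_mult)
    also have "exp (H * l) / exp (real K * ln l) = exp (H * l - real K * ln l)" by (rule exp_diff[symmetric])
    also have "\<dots> \<le> exp (- (7 * l))"
    proof -
      have "8 * (H * l) = 8 * (H * R) * ln l" using ll by (simp add: R_def)
      also have "\<dots> \<le> real K * ln l" using K ll by (intro mult_right_mono) auto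
      finally have "H * l - real K * ln l \<le> - (7 * (H * l))" by simp
      also have "\<dots> \<le> - (7 * l)" using H l by simp
      finally show ?thesis by simp
    qed
    also have "\<dots> = 1 / real n ^ 7"
      using n exp_of_nat_mult[of 7 l] by (simp add: l_def exp_minus inverse_eq_divide)
    finally show ?thesis .
  qed
  define V where "V = H * real (K + 1) ^ (d + 1)"
  have "regret_erm d n \<pi> \<le> ereal (2000000 * real d / real n * V)"
  proof (rule regret_erm_le[OF d n H(1), of K h])
    show HK: "H \<le> real (K + 1)" using HR K by simp
    then show hK: "h \<le> real (K + 1)" using H by simp
    show "measure_pmf.prob q {x. x k > K} \<le> 1 / real n ^ 7" if "k < d" for k
      using that by (rule tail)
    show "measure_pmf.prob q {x. b j x > h} \<le> 1 / real n ^ 7" if "j < d" for j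
      using b_le[OF that h0 h] by (simp add: not_less[symmetric])
    show "(\<Sum>x\<in>good j K h. cell_bound n j (real (K + 1)) x) \<le> 96 * V" if "j < d" for j
      using sum_cell_bound_bounded[OF that h0 H(2,1) hK b_le[OF that h0 h]] by (simp add: V_def mult.assoc)
    have "real (K + 1) ^ 2 \<le> 1 * real (K + 1) ^ (d + 1)"
      unfolding mult_1 using d by (intro power_increasing) auto
    also have "\<dots> \<le> V" unfolding V_def using H by (intro mult_right_mono) auto
    finally show "real (K + 1) ^ 2 \<le> V" .
    fix j assume j: "j < d"
    have "(\<integral>\<^sup>+\<theta>. ennreal (exp (1 / (2 * H) * \<theta> j)) \<partial>\<pi>) \<le> (\<integral>\<^sup>+\<theta>. ennreal 9 \<partial>\<pi>)"
    proof (rule nn_integral_mono_AE, use h in eventually_elim)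
      fix \<theta> :: "nat \<Rightarrow> real" assume "\<forall>j<d. \<theta> j \<le> h"
      then have "1 / (2 * H) * \<theta> j \<le> 1 / (2 * H) * H" using H j by (intro mult_left_mono) force+
      also have "\<dots> \<le> 1" using H by simp
      finally have "exp (1 / (2 * H) * \<theta> j) \<le> exp 1" by simp
      then show "ennreal (exp (1 / (2 * H) * \<theta> j)) \<le> ennreal 9"
        using exp_le by (intro ennreal_leI) linarith
    qed
    then show "(\<integral>\<^sup>+\<theta>. ennreal (exp (1 / (2 * H) * \<theta> j)) \<partial>\<pi>) \<le> 9" by (simp add: emeasure_space_1)
  qed
  also have "\<dots> \<le> ereal (2000000 * real d / real n * (max 10 (10 * h)) ^ (d + 2)
    * (ln (real n) / ln (ln (real n))) ^ (d + 1))"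
  proof -
    \<comment> \<open>The bare factor \<open>H\<close> is enlarged to \<open>10 * H\<close> so that
      it joins the \<open>d + 1\<close> others in a single power.\<close>
    have "V \<le> (10 * H) * (10 * (H * R)) ^ (d + 1)"
      unfolding V_def using H K by (intro mult_mono power_mono) auto
    also have "\<dots> = (10 * H) ^ (d + 2) * R ^ (d + 1)" by (simp add: power_mult_distrib)
    also have "10 * H = max 10 (10 * h)" by (auto simp: H_def max_def)
    finally have "2000000 * real d / real n * V \<le>
        2000000 * real d / real n * ((max 10 (10 * h)) ^ (d + 2) * R ^ (d + 1))"
      by (intro mult_left_mono) auto
    then show ?thesis by (simp add: R_def l_def mult.assoc)
  qed
  finally show ?thesis .
qed

text \<open>Slicing at multiples of \<open>S\<close>: on slice \<open>k\<close> the integrand is at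
  most \<open>r ^ -(k + 1)\<close> with \<open>r = exp (- 1 / 2)\<close>, while the tail is at most
  \<open>2 * r ^ (2 * k)\<close>. The exponential rate is half the tail rate, so a geometric series
  remains.\<close>

lemma subexp_exp_moment:
  assumes j: "j < d" and s: "s > 0" "s \<le> S"
    and tail: "\<And>t. t > 0 \<Longrightarrow> prob {\<theta>\<in>space \<pi>. t \<le> \<theta> j} \<le> 2 * exp (- t / s)"
  shows "(\<integral>\<^sup>+\<theta>. ennreal (exp (1 / (2 * S) * \<theta> j)) \<partial>\<pi>) \<le> 9"
proof -
  have S: "S > 0" using s by simp
  define A where "A k = {\<theta>\<in>space \<pi>. real k * S \<le> \<theta> j}" for k :: nat
  have meas: "A k \<in> sets \<pi>" for k unfolding A_def using j by measurable
  define r where "r = exp (- 1 / 2 :: real)"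
  have r: "0 < r" "r < 1" by (auto simp: r_def)
  have PA: "prob (A k) \<le> 2 * r ^ (2 * k)" for k
  \<comment> \<open>The tail hypothesis covers \<open>t > 0\<close> only; at 0 a probability is
    trivially at most 2.\<close>
  proof (cases "k = 0")
    case True
    have "prob (A k) \<le> 2" using prob_le_1[of "A k"] by linarith
    with True show ?thesis by simp
  next
    case False
    then have "prob (A k) \<le> 2 * exp (- (real k * S) / s)"
      unfolding A_def using S by (intro tail) auto
    also have "- (real k * S) / s \<le> - real k"
    proof -
      have "real k * s \<le> real k * S" using s by (intro mult_left_mono) auto
      then show ?thesis using s(1) by (simp add: field_simps)
    qed
    then have "2 * exp (- (real k * S) / s) \<le> 2 * exp (- real k)" by simp
    also have "exp (- real k) = r ^ (2 * k)"
      unfolding r_def by (simp add: exp_of_nat_mult[symmetric])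
    finally show ?thesis by simp
  qed
  have term_le_suminf: "f k \<le> (\<Sum>k. f k)" for f :: "nat \<Rightarrow> ennreal" and k
    using sum_le_suminf[OF summableI, of "{k}" f] by simp
  have "(\<integral>\<^sup>+\<theta>. ennreal (exp (1 / (2 * S) * \<theta> j)) \<partial>\<pi>) \<le>
      (\<integral>\<^sup>+\<theta>. (\<Sum>k. ennreal (1 / r ^ (k + 1)) * indicator (A k) \<theta>) \<partial>\<pi>)"
  proof (rule nn_integral_mono_AE, use AE_nonneg'[OF j] AE_space in eventually_elim)
    fix \<theta> assume \<theta>: "0 \<le> \<theta> j" "\<theta> \<in> space \<pi>"
    define k where "k = nat \<lfloor>\<theta> j / S\<rfloor>"
    have "0 \<le> \<theta> j / S" using \<theta> S by simp
    then have "real k \<le> \<theta> j / S" "\<theta> j / S \<le> real (k + 1)"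
      unfolding k_def by linarith+
    then have k: "real k * S \<le> \<theta> j" "1 / (2 * S) * \<theta> j \<le> real (k + 1) * (1 / 2)"
      using S by (auto simp: field_simps)
    have "exp (1 / (2 * S) * \<theta> j) \<le> exp (real (k + 1) * (1 / 2))" using k by simp
    also have "\<dots> = 1 / r ^ (k + 1)"
      unfolding exp_of_nat_mult r_def by (simp add: exp_minus inverse_eq_divide power_divide)
    finally have "ennreal (exp (1 / (2 * S) * \<theta> j)) \<le> ennreal (1 / r ^ (k + 1)) * indicator (A k) \<theta>"
      using k \<theta> by (simp add: A_def ennreal_leI)
    also have "\<dots> \<le> (\<Sum>k. ennreal (1 / r ^ (k + 1)) * indicator (A k) \<theta>)"
      by (rule term_le_suminf)
    finally show "ennreal (exp (1 / (2 * S) * \<theta> j)) \<le> (\<Sum>k. ennreal (1 / r ^ (k + 1)) * indicator (A k) \<theta>)" .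
  qed
  also have "\<dots> = (\<Sum>k. ennreal (1 / r ^ (k + 1)) * emeasure \<pi> (A k))"
    using meas by (subst nn_integral_suminf) (auto simp: nn_integral_cmult)
  also have "\<dots> \<le> (\<Sum>k. ennreal (2 / r * r ^ k))"
  proof (intro suminf_le summableI)
    fix k
    have "ennreal (1 / r ^ (k + 1)) * emeasure \<pi> (A k) = ennreal (1 / r ^ (k + 1) * prob (A k))"
      using r by (simp add: emeasure_eq_measure ennreal_mult[symmetric])
    also have "\<dots> \<le> ennreal (1 / r ^ (k + 1) * (2 * r ^ (2 * k)))"
      using PA r by (intro ennreal_leI mult_left_mono) auto
    also have "1 / r ^ (k + 1) * (2 * r ^ (2 * k)) = 2 / r * r ^ k"
    proof -
      have "1 / (u * r) * (2 * (u * u)) = 2 / r * u" if "u > 0" for u using that r by simp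
      from this[of "r ^ k"] show ?thesis using r by (simp only: mult_2 power_add power_one_right zero_less_power)
    qed
    finally show "ennreal (1 / r ^ (k + 1)) * emeasure \<pi> (A k) \<le> ennreal (2 / r * r ^ k)" .
  qed
  also have "\<dots> = ennreal (2 / r * (1 / (1 - r)))"
    using r by (intro suminf_ennreal_eq[OF _ sums_mult[OF geometric_sums]]) auto
  also have "\<dots> \<le> ennreal 9"
  proof (rule ennreal_leI)
    \<comment> \<open>The geometric series equals \<open>2 * y\<^sup>2 / (y - 1)\<close>. With
      \<open>y \<ge> 1.625\<close> and \<open>y\<^sup>2 = exp 1 < 2.72\<close>, it is below
      9.\<close>
    define y where "y = exp (1 / 2 :: real)"
    have ry: "r = 1 / y" by (simp add: r_def y_def exp_minus inverse_eq_divide)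
    have y: "1 + 1 / 2 + (1 / 2)\<^sup>2 / 2 \<le> y"
      unfolding y_def by (rule exp_lower_Taylor_quadratic) simp
    have "y\<^sup>2 = exp 1" by (simp add: y_def power2_eq_square mult_exp_exp)
    then have "2 * y\<^sup>2 \<le> 9 * (y - 1)" using y e_less_272 by (simp add: power2_eq_square)
    moreover have "2 / r * (1 / (1 - r)) = 2 * y\<^sup>2 / (y - 1)"
      using y unfolding ry by (simp add: field_simps power2_eq_square)
    moreover have "2 * y\<^sup>2 / (y - 1) \<le> 9" if "2 * y\<^sup>2 \<le> 9 * (y - 1)"
      using that y by (simp add: pos_divide_le_eq power2_eq_square)
    ultimately show "2 / r * (1 / (1 - r)) \<le> 9" by simp
  qed
  finally show ?thesis by simp
qed

lemma regret_erm_subexponential: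
  assumes d: "1 \<le> d" and n: "max d 3 \<le> n" and s: "s > 0"
    and tail: "\<And>j t. j < d \<Longrightarrow> t > 0 \<Longrightarrow> prob {\<theta>\<in>space \<pi>. t \<le> \<theta> j} \<le> 2 * exp (- t / s)"
  shows "regret_erm d n \<pi> \<le> ereal (2000000 * real d / real n * (max 42 (42 * s) * ln (real n)) ^ (d + 2))"
proof -
  define S where "S = max 1 s"
  define l where "l = ln (real n)"
  \<comment> \<open>Since \<open>1 + 1 / (2 * S) \<ge> exp (1 / (4 * S))\<close>, this
    \<open>K\<close> makes the Markov denominators at least \<open>n ^ 10\<close>; three powers
    absorb the moment bound 9. Rounding up and adding 1 turns 40 into 42.\<close>
  define K where "K = nat \<lceil>40 * (S * l)\<rceil>"
  have S: "1 \<le> S" "s \<le> S" by (auto simp: S_def)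
  have l: "1 < l" unfolding l_def using ln_gt_1_of_ge_3[of n] n by simp
  have Sl: "1 \<le> S * l" "S \<le> S * l" using S l mult_mono[of 1 S 1 l] mult_left_mono[of 1 l S] by auto
  have K: "40 * (S * l) \<le> real K" "real (K + 1) \<le> 42 * (S * l)"
    using Sl unfolding K_def by simp_all linarith+
  have E: "(\<integral>\<^sup>+\<theta>. ennreal (exp (1 / (2 * S) * \<theta> j)) \<partial>\<pi>) \<le> 9" if "j < d" for j
    using subexp_exp_moment[OF that s S(2) tail[OF that]] .
  have nl: "real n = exp l" using n by (simp add: l_def)
  have small: "9 / c \<le> 1 / real n ^ 7" if c: "exp (10 * l) \<le> c" for c
  proof -
    have "9 \<le> real n ^ 3"
      using n power_mono[of 3 "real n" 3] by simp
    then have "9 * real n ^ 7 \<le> real n ^ 3 * real n ^ 7" by (intro mult_right_mono) auto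
    also have "\<dots> = exp (10 * l)" unfolding nl power_add[symmetric] by (simp add: exp_of_nat_mult[symmetric])
    also have "\<dots> \<le> c" by (rule c)
    finally have *: "9 * real n ^ 7 \<le> c" .
    have "0 < c" using c exp_gt_zero[of "10 * l"] by linarith
    then show ?thesis using * n by (simp add: field_simps)
  qed
  define V where "V = real (K + 1) ^ (d + 2)"
  have "regret_erm d n \<pi> \<le> ereal (2000000 * real d / real n * V)"
  proof (rule regret_erm_le[OF d n S(1), of K "real K"])
    show "S \<le> real (K + 1)" using Sl K by simp
    show "real K \<le> real (K + 1)" by simp
    show "(\<integral>\<^sup>+\<theta>. ennreal (exp (1 / (2 * S) * \<theta> j)) \<partial>\<pi>) \<le> 9" if "j < d" for j
      using that by (rule E)
    show "measure_pmf.prob q {x. x k > K} \<le> 1 / real n ^ 7" if k: "k < d" for k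
    proof -
      have "measure_pmf.prob q {x. x k > K} \<le> 9 / (1 + 1 / (2 * S)) ^ K"
        using moment_bounds(3)[OF S(1) k E[OF k]] S
        by (intro Markov_pmf[where f="\<lambda>x. (1 + 1 / (2 * S)) ^ x k"]) (auto intro: power_increasing intro!: zero_less_power add_pos_nonneg)
      also have "\<dots> \<le> 1 / real n ^ 7"
      proof (rule small)
        have "10 * l = 40 * (S * l) * (1 / (2 * S) / 2)" using S by simp
        also have "\<dots> \<le> real K * ln (1 + 1 / (2 * S))"
          using K S Sl by (intro mult_mono half_le_ln_one_plus) (auto simp: field_simps)
        finally have "exp (10 * l) \<le> exp (real K * ln (1 + 1 / (2 * S)))" by simp
        also have "\<dots> = (1 + 1 / (2 * S)) ^ K"
          using S by (simp add: exp_of_nat_mult add_pos_nonneg)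
        finally show "exp (10 * l) \<le> (1 + 1 / (2 * S)) ^ K" .
      qed
      finally show ?thesis .
    qed
    show "measure_pmf.prob q {x. b j x > real K} \<le> 1 / real n ^ 7" if j: "j < d" for j
    proof -
      have "measure_pmf.prob q {x. b j x > real K} \<le> 9 / exp (1 / (2 * S) * real K)"
        using moment_bounds(4)[OF S(1) j E[OF j]] S
        by (intro Markov_pmf[where f="\<lambda>x. exp (1 / (2 * S) * b j x)"]) (auto simp: divide_right_mono)
      also have "\<dots> \<le> 1 / real n ^ 7"
      proof (rule small)
        have "20 * l = 1 / (2 * S) * (40 * (S * l))" using S by simp
        also have "\<dots> \<le> 1 / (2 * S) * real K" using K S by (intro mult_left_mono) auto
        finally show "exp (10 * l) \<le> exp (1 / (2 * S) * real K)" using l by simp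
      qed
      finally show ?thesis .
    qed
    show "(\<Sum>x\<in>good j K (real K). cell_bound n j (real (K + 1)) x) \<le> 96 * V" if "j < d" for j
    proof -
      have "(\<Sum>x\<in>good j K (real K). cell_bound n j (real (K + 1)) x) \<le> 40 * V"
        unfolding V_def by (rule sum_cell_bound_le[OF that]) simp
      also have "\<dots> \<le> 96 * V" by (simp add: V_def)
      finally show ?thesis .
    qed
    show "real (K + 1) ^ 2 \<le> V"
      unfolding V_def by (intro power_increasing) auto
  qed
  also have "\<dots> \<le> ereal (2000000 * real d / real n * (max 42 (42 * s) * ln (real n)) ^ (d + 2))"
  proof -
    have "V \<le> (42 * (S * l)) ^ (d + 2)" unfolding V_def using K by (intro power_mono) auto
    also have "42 * (S * l) = max 42 (42 * s) * ln (real n)" by (auto simp: S_def l_def max_def)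
    finally have "2000000 * real d / real n * V \<le>
        2000000 * real d / real n * (max 42 (42 * s) * ln (real n)) ^ (d + 2)"
      by (rule mult_left_mono) simp
    then show ?thesis by simp
  qed
  finally show ?thesis .
qed

end

theorem theorem2:
  "\<exists>C c1 c2 c3 c4 :: real. C > 0 \<and> c1 > 0 \<and> c2 > 0 \<and> c3 > 0 \<and> c4 > 0 \<and>
    (\<forall>d n :: nat. \<forall>\<pi> :: (nat \<Rightarrow> real) measure.
       1 \<le> d \<and> max d 3 \<le> n \<and> prob_space \<pi> \<and>
       sets \<pi> = sets (PiM {..<d} (\<lambda>_. borel)) \<and>
       (AE \<theta> in \<pi>. \<forall>j<d. 0 \<le> \<theta> j) \<longrightarrow>
       (\<forall>h::real. (AE \<theta> in \<pi>. \<forall>j<d. \<theta> j \<le> h) \<longrightarrow>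
          regret_erm d n \<pi> \<le> ereal (C * real d / real n * (max c1 (c2 * h)) ^ (d + 2)
                                  * (ln (real n) / ln (ln (real n))) ^ (d + 1))) \<and>
       (\<forall>s::real. s > 0 \<and>
          (\<forall>j<d. \<forall>t>0. measure \<pi> {\<theta>\<in>space \<pi>. t \<le> \<theta> j} \<le> 2 * exp (- t / s)) \<longrightarrow>
          regret_erm d n \<pi> \<le> ereal (C * real d / real n * (max c3 (c4 * s) * ln (real n)) ^ (d + 2))))"
proof -
  have "(\<forall>h::real. (AE \<theta> in \<pi>. \<forall>j<d. \<theta> j \<le> h) \<longrightarrow>
          regret_erm d n \<pi> \<le> ereal (2000000 * real d / real n * (max 10 (10 * h)) ^ (d + 2)
                                  * (ln (real n) / ln (ln (real n))) ^ (d + 1))) \<and>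
       (\<forall>s::real. s > 0 \<and>
          (\<forall>j<d. \<forall>t>0. measure \<pi> {\<theta>\<in>space \<pi>. t \<le> \<theta> j} \<le> 2 * exp (- t / s)) \<longrightarrow>
          regret_erm d n \<pi> \<le> ereal (2000000 * real d / real n * (max 42 (42 * s) * ln (real n)) ^ (d + 2)))"
    if "1 \<le> d \<and> max d 3 \<le> n \<and> prob_space \<pi> \<and>
       sets \<pi> = sets (PiM {..<d} (\<lambda>_. borel)) \<and> (AE \<theta> in \<pi>. \<forall>j<d. 0 \<le> \<theta> j)"
    for d n :: nat and \<pi> :: "(nat \<Rightarrow> real) measure"
  proof -
    interpret poisson_mixture \<pi> d
      using that by (intro poisson_mixture.intro poisson_mixture_axioms.intro) auto
    show ?thesis
      using that regret_erm_bounded[of n] regret_erm_subexponential[of n] by blast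
  qed
  then show ?thesis
    by (rule_tac x = 2000000 in exI, rule_tac x = 10 in exI, rule_tac x = 10 in exI,
        rule_tac x = 42 in exI, rule_tac x = 42 in exI)
      (intro conjI[OF zero_less_numeral] allI impI)
qed

end
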